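(* Let $X$ be a compact metric space, $T\colon X\to X$ a continuous map, and suppose $(X,T)$ is uniquely ergodic with unique $T$-invariant Borel probability measure $\mu$. Then $$\lim_{N\to\infty}\frac1N\sum_{n=1}^N f\big(T^{\omega(n)}x\big)=\int f\,d\mu$$ for every $f\in C(X)$ and every $x\in X$.
   Context: $\omega(n)$ denotes the number of distinct prime factors of $n\in\mathbb{N}=\{1,2,3,\ldots\}$ (counted without multiplicity). $C(X)$ is the space of continuous complex-valued functions on $X$. $(X,T)$ is uniquely ergodic if there is exactly one Borel probability measure $\mu$ on $X$ with $\mu(T^{-1}A)=\mu(A)$ for all Borel $A\subset X$. *)

theory Defs
  imports "HOL-Probability.Probability" "HOL-Computational_Algebra.Primes"
begin

definition omega :: "nat \<Rightarrow> nat" where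
  "omega n = card (prime_factors n)"

text \<open>The compact metric space is a subset \<open>X\<close> of a metric space type, with the induced metric.
  Its Borel \<open>\<sigma>\<close>-algebra is that of \<open>restrict_space borel X\<close>, so that a Borel measure on \<open>X\<close>
  has space \<open>X\<close>, and preimages under the total function \<open>T\<close> have to be cut down to \<open>X\<close>.\<close>

definition invariant_prob_measure ::
    "'a::metric_space set \<Rightarrow> ('a \<Rightarrow> 'a) \<Rightarrow> 'a measure \<Rightarrow> bool" where
  "invariant_prob_measure X T \<mu> \<longleftrightarrow>
     prob_space \<mu> \<and> sets \<mu> = sets (restrict_space borel X) \<and>
     (\<forall>A \<in> sets \<mu>. emeasure \<mu> (T -` A \<inter> X) = emeasure \<mu> A)"

definition uniquely_ergodic :: "'a::metric_space set \<Rightarrow> ('a \<Rightarrow> 'a) \<Rightarrow> bool" where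
  "uniquely_ergodic X T \<longleftrightarrow> (\<exists>!\<mu>. invariant_prob_measure X T \<mu>)"

end

theory Submission
  imports Defs "HOL-Computational_Algebra.Squarefree" "HOL-Analysis.Harmonic_Numbers"
    "HOL-Real_Asymp.Real_Asymp"
begin

text \<open>
  The point is that for every bounded sequence \<open>a\<close> the averages \<open>A x\<close> of \<open>a (omega n)\<close> and \<open>A' x\<close> of
  \<open>a (omega n + 1)\<close> over \<open>n \<le> x\<close> have difference tending to \<open>0\<close>. Then every weak limit of the empirical
  measures along \<open>T ^^ omega n\<close> is \<open>T\<close>-invariant, hence equal to \<open>\<mu>\<close>.

  By the dual Turan--Kubilius inequality, \<open>A' (x / p)\<close> is close to \<open>A x\<close> for all primes \<open>p\<close> outside a set
  over which the sum of \<open>1 / p\<close> is bounded. Replacing \<open>A' (x / p)\<close> by \<open>A' x\<close> requires \<open>A (c * x) - A x\<close> to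
  tend to \<open>0\<close> for fixed \<open>c\<close>. If there are enough pairs of primes with \<open>ln p - ln q\<close> close to \<open>h\<close>, then
  comparing \<open>A' (x / p)\<close> with \<open>A' (exp h * x / q)\<close> shows this for \<open>c = exp h\<close>, and arbitrarily small such
  \<open>h\<close> suffice because \<open>A\<close> is Lipschitz in \<open>ln x\<close>. They exist since an interval of length \<open>\<eta> y\<close> at \<open>y\<close>
  contains few primes for small \<open>\<eta>\<close>, as they divide a binomial coefficient, whereas by Euler the
  inverses of the primes up to \<open>x\<close> add up to at least \<open>ln (ln x) - O(1)\<close>.
\<close>

section \<open>Sums of inverses of primes\<close>

lemma sum_inverse_squares_le: "(\<Sum>n = 1..N. 1 / real n ^ 2) \<le> 2"
proof -
  \<comment> \<open>The subtracted term carries the induction: \<open>1 / (N + 1)^2\<close> is at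
    most the telescoping difference \<open>1 / N - 1 / (N + 1)\<close>.\<close>
  have "(\<Sum>n = 1..N. 1 / real n ^ 2) \<le> 2 - 1 / real N" if "N \<ge> 1" for N
    using that
  proof (induction N rule: dec_induct)
    case (step N)
    have "1 / real (Suc N) ^ 2 \<le> 1 / (real N * real (Suc N))"
      using step.hyps by (intro divide_left_mono) (auto simp: power2_eq_square)
    also have "\<dots> = 1 / real N - 1 / real (Suc N)"
      using step.hyps by (simp add: field_simps)
    finally show ?case using step.IH by simp
  qed simp
  from this[of N] show ?thesis
    by (cases "N \<ge> 1") (auto intro: order_trans)
qed

text \<open>Euler's argument with squarefree numbers: writing \<open>n\<close> as a square times a squarefree number
  bounds the harmonic sum by a constant multiple of the product of all \<open>1 + 1/p\<close>.\<close>

lemma harm_le_prod_primes: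
  "(harm N :: real) \<le> 2 * (\<Prod>p | prime p \<and> p \<le> N. 1 + 1 / real p)"
proof -
  define P where "P = {p::nat. prime p \<and> p \<le> N}"
  have "finite P" by (simp add: P_def)
  define F where "F n = (square_part n, prime_factors (squarefree_part n))" for n :: nat
  have prod: "\<Prod>(prime_factors (squarefree_part n)) = squarefree_part n" for n :: nat
  proof -
    have "multiplicity p (squarefree_part n) = 1" if "p \<in> prime_factors (squarefree_part n)" for p
    proof -
      have "prime p" "multiplicity p (squarefree_part n) \<noteq> 0"
        using that by (auto simp: prime_factors_multiplicity)
      then show ?thesis
        using prime_multiplicity_squarefree_part[of p n] by presburger
    qed
    then have "(\<Prod>p\<in>prime_factors (squarefree_part n). p ^ multiplicity p (squarefree_part n))
        = (\<Prod>p\<in>prime_factors (squarefree_part n). p)"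
      by (intro prod.cong refl) simp
    then show ?thesis
      using prod_prime_factors[of "squarefree_part n"] by simp
  qed
  have dec: "n = \<Prod>(snd (F n)) * fst (F n) ^ 2" for n
    using squarefree_decompose[of n] prod by (simp add: F_def)
  have inj: "inj_on F {1..N}"
    by (rule inj_onI) (metis dec)
  have sub: "F ` {1..N} \<subseteq> {1..N} \<times> Pow P"
  proof
    fix z assume "z \<in> F ` {1..N}"
    then obtain n where n: "n \<in> {1..N}" "z = F n" by blast
    have "square_part n \<ge> 1"
      using n by (simp add: Suc_le_eq neq0_conv[symmetric] del: neq0_conv)
    moreover have "square_part n \<le> square_part n ^ 2"
      by (simp add: power2_eq_square)
    moreover have "square_part n ^ 2 \<le> n"
      using n by (intro dvd_imp_le) auto
    ultimately have 1: "square_part n \<in> {1..N}"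
      using n by simp
    have "p \<le> N" if "p \<in> prime_factors (squarefree_part n)" for p
    proof -
      have "p dvd n"
        using that squarefree_decompose[of n] by (metis dvd_mult2 in_prime_factors_imp_dvd)
      then show ?thesis using n by (auto dest: dvd_imp_le)
    qed
    then have "prime_factors (squarefree_part n) \<subseteq> P"
      by (auto simp: P_def)
    then show "z \<in> {1..N} \<times> Pow P"
      using 1 n by (simp add: F_def)
  qed
  have "harm N = (\<Sum>n\<in>{1..N}. 1 / real n)"
    by (simp add: harm_def inverse_eq_divide)
  also have "\<dots> = (\<Sum>n\<in>{1..N}. (case F n of (m, S) \<Rightarrow> 1 / real m ^ 2 * (1 / real (\<Prod>S))))"
    by (rule sum.cong[OF refl], subst dec) (simp add: case_prod_beta)
  also have "\<dots> = (\<Sum>z\<in>F ` {1..N}. (case z of (m, S) \<Rightarrow> 1 / real m ^ 2 * (1 / real (\<Prod>S))))"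
    by (subst sum.reindex[OF inj]) simp
  \<comment> \<open>Admitting all pairs only adds nonnegative terms. The double sum then factors,
    and its sum over subsets of \<open>P\<close> is the expanded product.\<close>
  also have "\<dots> \<le> (\<Sum>z\<in>{1..N} \<times> Pow P. (case z of (m, S) \<Rightarrow> 1 / real m ^ 2 * (1 / real (\<Prod>S))))"
    using sub \<open>finite P\<close> by (intro sum_mono2) (auto simp: case_prod_beta simp del: of_nat_prod)
  also have "\<dots> = (\<Sum>m = 1..N. 1 / real m ^ 2) * (\<Sum>S\<in>Pow P. 1 / real (\<Prod>S))"
    by (simp add: sum_product sum.cartesian_product)
  also have "(\<Sum>S\<in>Pow P. 1 / real (\<Prod>S)) = (\<Prod>p\<in>P. 1 / real p + 1)"
    using prod_add[OF \<open>finite P\<close>, of "\<lambda>p. 1 / real p" "\<lambda>_. 1"] by (simp add: prod_dividef)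
  also have "(\<Sum>m = 1..N. 1 / real m ^ 2) * (\<Prod>p\<in>P. 1 / real p + 1) \<le> 2 * (\<Prod>p\<in>P. 1 / real p + 1)"
    by (intro mult_right_mono sum_inverse_squares_le prod_nonneg) auto
  finally show ?thesis
    by (simp add: P_def add.commute)
qed

text \<open>A weak form of Mertens' theorem: \<open>1 + t \<le> exp t\<close> turns Euler's product
  into the exponential of the sum, and taking logarithms turns the factor 2 into
  \<open>ln 2\<close>.\<close>

lemma sum_inverse_primes_ge:
  assumes "N \<ge> 1"
  shows "(\<Sum>p | prime p \<and> p \<le> N. 1 / real p) \<ge> ln (ln (real N + 1)) - ln 2"
proof -
  have pos: "ln (real N + 1) > 0" using assms by simp
  have "ln (real N + 1) \<le> harm N"
    by (rule ln_le_harm)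
  also have "\<dots> \<le> 2 * (\<Prod>p | prime p \<and> p \<le> N. 1 + 1 / real p)"
    by (rule harm_le_prod_primes)
  also have "(\<Prod>p | prime p \<and> p \<le> N. 1 + 1 / real p) \<le> (\<Prod>p | prime p \<and> p \<le> N. exp (1 / real p))"
    by (intro prod_mono) (auto intro: add_nonneg_nonneg)
  also have "\<dots> = exp (\<Sum>p | prime p \<and> p \<le> N. 1 / real p)"
    by (simp add: exp_sum)
  finally have "ln (ln (real N + 1)) \<le> ln (2 * exp (\<Sum>p | prime p \<and> p \<le> N. 1 / real p))"
    using pos by (subst ln_le_cancel_iff) auto
  then show ?thesis
    by (simp add: ln_mult)
qed

text \<open>The primes of a short interval divide a binomial coefficient \<open>N choose r\<close>, which by the binomial
  theorem is at most \<open>(1 + \<lambda>)^N / \<lambda>^r\<close>.\<close>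

lemma prod_primes_le_binomial:
  assumes "finite Q" "\<And>p. p \<in> Q \<Longrightarrow> prime p \<and> N - r < p \<and> p \<le> N" "2 * r \<le> N"
  shows "\<Prod>Q \<le> N choose r"
proof -
  have "\<Prod>Q dvd (N choose r)"
    using assms(1,2)
  proof (induction Q rule: finite_induct)
    case (insert p Q)
    have p: "prime p" "N - r < p" "p \<le> N" using insert.prems by auto
    \<comment> \<open>The product is \<open>fact N\<close>, which \<open>p\<close> divides; since
      \<open>r \<le> N - r < p\<close>, it divides neither of the two factorials.\<close>
    have "p dvd fact r * fact (N - r) * (N choose r)"
      using p assms(3) by (subst binomial_fact_lemma) (auto simp: prime_dvd_fact_iff)
    then have "p dvd (N choose r)"
      using p assms(3) by (auto simp: prime_dvd_mult_iff prime_dvd_fact_iff)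
    moreover have "coprime p (\<Prod>Q)"
      using insert p by (intro prod_coprime_right) (auto intro!: primes_coprime)
    ultimately show ?case
      using insert by (simp add: divides_mult)
  qed simp
  then show ?thesis
    using assms(3) by (intro dvd_imp_le) auto
qed

text \<open>The parameter \<open>l\<close> stays free: fixed first, it makes \<open>l * N\<close> a
  small part of \<open>N\<close>; afterwards a small ratio \<open>r / N\<close> outweighs
  \<open>ln (1 / l)\<close>.\<close>

lemma ln_binomial_le:
  assumes "0 < l" "r \<le> N"
  shows "ln (real (N choose r)) \<le> l * real N + real r * ln (1 / l)"
proof -
  have "real (N choose r) * l ^ r \<le> (\<Sum>k\<le>N. real (N choose k) * l ^ k)"
    using assms by (intro member_le_sum) auto
  also have "\<dots> = (1 + l) ^ N"
    using binomial_ring[of l 1 N] by (simp add: add.commute)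
  finally have "ln (real (N choose r) * l ^ r) \<le> ln ((1 + l) ^ N)"
    using assms by (subst ln_le_cancel_iff) auto
  then have "ln (real (N choose r)) + real r * ln l \<le> real N * ln (1 + l)"
    using assms by (simp add: ln_mult ln_realpow)
  moreover have "real N * ln (1 + l) \<le> real N * l"
    using assms by (intro mult_left_mono ln_add_one_self_le_self) auto
  ultimately show ?thesis
    using assms by (simp add: ln_div mult.commute)
qed

text \<open>All primes counted are at least \<open>y\<close> and their product is at most a binomial
  coefficient, so there are at most \<open>\<kappa> * y / ln y\<close> of them, each with inverse at
  most \<open>1 / y\<close>.\<close>

lemma sum_inverse_primes_short_interval:
  assumes "\<kappa> > 0"
  obtains \<eta> y0 :: real where "\<eta> > 0" "y0 \<ge> 2"
    "\<And>y. y \<ge> y0 \<Longrightarrow> (\<Sum>p | prime p \<and> y \<le> real p \<and> real p \<le> (1 + \<eta>) * y. 1 / real p) \<le> \<kappa> / ln y"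
proof -
  define l where "l = min (1/2) (\<kappa> / 4)"
  have l: "0 < l" "l \<le> \<kappa> / 4" "l < 1" using assms by (auto simp: l_def)
  then have L: "ln (1 / l) > 0" by simp
  \<comment> \<open>The second entry makes the term with \<open>ln (1 / l)\<close> at most
    \<open>\<kappa> / 2 * y\<close>, which is also the bound that \<open>l\<close> gives for the
    other term; \<open>1/16\<close> secures \<open>2 * r \<le> N\<close>.\<close>
  define \<eta> where "\<eta> = min (1/16) (\<kappa> / (4 * ln (1 / l)))"
  have \<eta>: "0 < \<eta>" "\<eta> \<le> 1/16" "\<eta> \<le> \<kappa> / (4 * ln (1 / l))"
    using assms L by (auto simp: \<eta>_def)
  then have \<eta>L: "2 * \<eta> * ln (1 / l) \<le> \<kappa> / 2"
    using L by (simp add: field_simps)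
  show ?thesis
  proof
    show "\<eta> > 0" by fact
    show "max 2 (1 / \<eta>) \<ge> 2" by simp
    fix y assume y: "y \<ge> max 2 (1 / \<eta>)"
    define Q where "Q = {p. prime p \<and> y \<le> real p \<and> real p \<le> (1 + \<eta>) * y}"
    define N where "N = nat \<lfloor>(1 + \<eta>) * y\<rfloor>"
    \<comment> \<open>The largest integer below \<open>y\<close>, so that \<open>Q\<close> lies
      among the \<open>r\<close> integers above \<open>M\<close> and up to \<open>N\<close>. As
      \<open>\<eta> * y \<ge> 1\<close>, rounding at most doubles the length
      \<open>\<eta> * y\<close>.\<close>
    define M where "M = nat \<lceil>y\<rceil> - 1"
    define r where "r = N - M"
    have N: "real N \<le> (1 + \<eta>) * y" "(1 + \<eta>) * y < real N + 1"
      using y \<eta> unfolding N_def by (auto simp: of_nat_nat)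
    have M: "real M < y" "y \<le> real M + 1"
      using y unfolding M_def by (auto simp: of_nat_diff of_nat_nat) linarith+
    have ey: "\<eta> * y \<ge> 1" using y \<eta> by (simp add: field_simps)
    have NM: "M \<le> N" using N M ey by (simp add: algebra_simps)
    have "real r = real N - real M" using NM by (simp add: r_def)
    then have r: "real r \<le> 2 * (\<eta> * y)" using N M ey by (simp add: algebra_simps)
    have ey2: "\<eta> * y \<le> 1/16 * y" using \<eta> y by (intro mult_right_mono) auto
    have "2 * r \<le> N"
    proof -
      have "(1 + \<eta>) * y = y + \<eta> * y" by (simp add: algebra_simps)
      then have "2 * real r \<le> real N" using r N(2) ey ey2 y by linarith
      then show ?thesis by linarith
    qed
    have Qf: "finite Q"
      by (rule finite_subset[of _ "{..N}"])
        (auto simp: Q_def N_def le_nat_iff le_floor_iff)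
    have "p \<in> Q \<Longrightarrow> prime p \<and> N - r < p \<and> p \<le> N" for p
      using NM M unfolding Q_def N_def r_def by (auto simp: le_nat_iff le_floor_iff)
    then have "\<Prod>Q \<le> N choose r"
      using Qf \<open>2 * r \<le> N\<close> by (intro prod_primes_le_binomial) auto
    moreover have "y ^ card Q \<le> real (\<Prod>Q)"
      using prod_mono[of Q "\<lambda>_. y" real] y by (simp add: Q_def)
    ultimately have "y ^ card Q \<le> real (N choose r)"
      by linarith
    then have "ln (y ^ card Q) \<le> ln (real (N choose r))"
      using y \<open>2 * r \<le> N\<close> by (subst ln_le_cancel_iff) auto
    also have "\<dots> \<le> l * real N + real r * ln (1 / l)"
      using l \<open>2 * r \<le> N\<close> by (intro ln_binomial_le) auto
    also have "\<dots> \<le> l * (2 * y) + 2 * (\<eta> * y) * ln (1 / l)"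
    proof (intro add_mono mult_left_mono mult_right_mono)
      have "(1 + \<eta>) * y = y + \<eta> * y" by (simp add: algebra_simps)
      then show "real N \<le> 2 * y" using N(1) ey2 y by linarith
    qed (use l L r in auto)
    also have "\<dots> \<le> \<kappa> / 4 * (2 * y) + (\<kappa> / 2) * y"
      using l y mult_right_mono[OF \<eta>L, of y] by (intro add_mono mult_right_mono) (auto simp: mult_ac)
    finally have *: "real (card Q) * ln y \<le> \<kappa> * y"
      using y by (simp add: ln_realpow)
    have "(\<Sum>p\<in>Q. 1 / real p) \<le> (\<Sum>p\<in>Q. 1 / y)"
      using y by (intro sum_mono divide_left_mono) (auto simp: Q_def)
    also have "\<dots> = real (card Q) / y" by simp
    also have "\<dots> \<le> \<kappa> / ln y"
      using * y by (simp add: field_simps)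
    finally show "(\<Sum>p | prime p \<and> y \<le> real p \<and> real p \<le> (1 + \<eta>) * y. 1 / real p) \<le> \<kappa> / ln y"
      by (simp add: Q_def)
  qed
qed

section \<open>The dual Turan--Kubilius inequality\<close>

text \<open>The argument is real and is itself the divisor, so that averages can be taken at
  \<open>x / p\<close> and under dilations; at positive integers this is the usual mean.\<close>

definition omega_avg :: "(nat \<Rightarrow> real) \<Rightarrow> real \<Rightarrow> real" where
  "omega_avg a x = (\<Sum>n = 1..nat \<lfloor>x\<rfloor>. a (omega n)) / x"

section \<open>Counting multiples up to a real bound\<close>

lemma le_nat_floor_iff: "x \<ge> 0 \<Longrightarrow> n \<le> nat \<lfloor>x\<rfloor> \<longleftrightarrow> real n \<le> x"
  by (simp add: le_nat_iff le_floor_iff)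

lemma multiples_upto:
  assumes "d > 0" "x \<ge> 0"
  shows "{n \<in> {1..nat \<lfloor>x\<rfloor>}. d dvd n} = (*) d ` {1..nat \<lfloor>x / real d\<rfloor>}"
proof (intro equalityI subsetI)
  fix n assume "n \<in> {n \<in> {1..nat \<lfloor>x\<rfloor>}. d dvd n}"
  then obtain m where "n = d * m" "1 \<le> d * m" "real (d * m) \<le> x"
    using assms by (auto simp: le_nat_floor_iff)
  then show "n \<in> (*) d ` {1..nat \<lfloor>x / real d\<rfloor>}"
    using assms by (auto simp: le_nat_floor_iff field_simps intro!: image_eqI[of _ _ m] Suc_leI)
next
  fix n assume "n \<in> (*) d ` {1..nat \<lfloor>x / real d\<rfloor>}"
  then obtain m where "n = d * m" "1 \<le> m" "real m \<le> x / real d"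
    using assms by (auto simp: le_nat_floor_iff)
  then show "n \<in> {n \<in> {1..nat \<lfloor>x\<rfloor>}. d dvd n}"
    using assms by (auto simp: le_nat_floor_iff field_simps Suc_le_eq)
qed

lemma sum_multiples_upto:
  fixes g :: "nat \<Rightarrow> real"
  assumes "d > 0" "x \<ge> 0"
  shows "(\<Sum>n = 1..nat \<lfloor>x\<rfloor>. of_bool (d dvd n) * g n) = (\<Sum>m = 1..nat \<lfloor>x / real d\<rfloor>. g (d * m))"
proof -
  have "(\<Sum>n = 1..nat \<lfloor>x\<rfloor>. of_bool (d dvd n) * g n) = (\<Sum>n | n \<in> {1..nat \<lfloor>x\<rfloor>} \<and> d dvd n. g n)"
    by (rule sum.mono_neutral_cong_right) auto
  also have "\<dots> = (\<Sum>m = 1..nat \<lfloor>x / real d\<rfloor>. g (d * m))"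
    using assms multiples_upto[OF assms] by (simp add: sum.reindex inj_on_def)
  finally show ?thesis .
qed

lemma count_multiples_upto:
  assumes "d > 0" "x \<ge> 0"
  obtains \<theta> where "0 \<le> \<theta>" "\<theta> \<le> 1"
    "(\<Sum>n = 1..nat \<lfloor>x\<rfloor>. of_bool (d dvd n)) = x / real d - \<theta>"
proof
  have "(\<Sum>n = 1..nat \<lfloor>x\<rfloor>. of_bool (d dvd n) * (1::real)) = real (nat \<lfloor>x / real d\<rfloor>)"
    by (subst sum_multiples_upto[OF assms]) simp
  then show "(\<Sum>n = 1..nat \<lfloor>x\<rfloor>. of_bool (d dvd n)) = x / real d - (x / real d - real (nat \<lfloor>x / real d\<rfloor>))"
    by simp
  have "x / real d \<ge> 0" using assms by simp
  then have eq: "real (nat \<lfloor>x / real d\<rfloor>) = of_int \<lfloor>x / real d\<rfloor>" by simp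
  show "0 \<le> x / real d - real (nat \<lfloor>x / real d\<rfloor>)" "x / real d - real (nat \<lfloor>x / real d\<rfloor>) \<le> 1"
    unfolding eq using of_int_floor_le[of "x / real d"] floor_correct[of "x / real d"] by linarith+
qed

text \<open>Divisibility by different primes is almost independent: after centring, the main terms
  \<open>x / (p * q)\<close> cancel and only four rounding errors of size at most 1 remain. On the
  diagonal a variance of at most \<open>x / p\<close> survives.\<close>

lemma prime_indicator_correlation:
  assumes "prime p" "prime q" "x \<ge> 0"
  shows "p \<noteq> q \<Longrightarrow> \<bar>\<Sum>n = 1..nat \<lfloor>x\<rfloor>. (of_bool (p dvd n) - 1 / real p) * (of_bool (q dvd n) - 1 / real q)\<bar> \<le> 4"
    and "p = q \<Longrightarrow> (\<Sum>n = 1..nat \<lfloor>x\<rfloor>. (of_bool (p dvd n) - 1 / real p) * (of_bool (q dvd n) - 1 / real q)) \<le> x / real p + 4"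
proof -
  have pos: "p > 0" "q > 0" "real p \<ge> 1" "real q \<ge> 1"
    using assms prime_gt_0_nat[of p] prime_gt_0_nat[of q] by (auto simp: Suc_le_eq)
  define c where "c d = (\<Sum>n = 1..nat \<lfloor>x\<rfloor>. of_bool (d dvd n) :: real)" for d
  \<comment> \<open>The least common multiple of \<open>p\<close> and \<open>q\<close>.\<close>
  define r where "r = (if p = q then p else p * q)"
  have rdvd: "of_bool (p dvd n) * of_bool (q dvd n) = (of_bool (r dvd n) :: real)" for n
  proof -
    have "p dvd n \<and> q dvd n \<longleftrightarrow> r dvd n"
    proof (cases "p = q")
      case False
      then have "coprime p q"
        using assms(1,2) by (rule primes_coprime[rotated 2])
      then show ?thesis
        using False by (metis r_def divides_mult dvd_mult_left dvd_mult_right)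
    qed (simp add: r_def)
    then show ?thesis
      by (simp flip: of_bool_conj)
  qed
  \<comment> \<open>The constant term is written with \<open>1 dvd n\<close>, so that all four terms
    sum to counts of multiples.\<close>
  have "(of_bool (p dvd n) - 1 / real p) * (of_bool (q dvd n) - 1 / real q)
      = of_bool (r dvd n) - of_bool (p dvd n) / q - of_bool (q dvd n) / p
        + of_bool (1 dvd n) / (real p * real q)" for n
  proof -
    have "(u - 1 / y) * (v - 1 / z) = u * v - u / z - v / y + 1 / (y * z)" for u v y z :: real
      by (simp add: algebra_simps)
    from this[of "of_bool (p dvd n)" "real p" "of_bool (q dvd n)" "real q"] show ?thesis
      by (simp only: rdvd one_dvd of_bool_eq)
  qed
  then have eq: "(\<Sum>n = 1..nat \<lfloor>x\<rfloor>. (of_bool (p dvd n) - 1 / real p) * (of_bool (q dvd n) - 1 / real q))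
      = c r - c p / q - c q / p + c 1 / (real p * real q)"
    unfolding c_def by (simp only: sum.distrib sum_subtractf sum_divide_distrib)
  have "r > 0" using pos by (simp add: r_def)
  obtain \<theta>1 where \<theta>1: "0 \<le> \<theta>1" "\<theta>1 \<le> 1" "c r = x / real r - \<theta>1"
    using count_multiples_upto[OF \<open>r > 0\<close> assms(3)] unfolding c_def .
  obtain \<theta>2 where \<theta>2: "0 \<le> \<theta>2" "\<theta>2 \<le> 1" "c p = x / real p - \<theta>2"
    using count_multiples_upto[OF pos(1) assms(3)] unfolding c_def .
  obtain \<theta>3 where \<theta>3: "0 \<le> \<theta>3" "\<theta>3 \<le> 1" "c q = x / real q - \<theta>3"
    using count_multiples_upto[OF pos(2) assms(3)] unfolding c_def .
  obtain \<theta>4 where \<theta>4: "0 \<le> \<theta>4" "\<theta>4 \<le> 1" "c 1 = x / real 1 - \<theta>4"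
    using count_multiples_upto[of 1 x] assms(3) unfolding c_def by auto
  have eq2: "(\<Sum>n = 1..nat \<lfloor>x\<rfloor>. (of_bool (p dvd n) - 1 / real p) * (of_bool (q dvd n) - 1 / real q))
      = (x / real r - x / (real p * real q)) + (\<theta>2 / q + \<theta>3 / p - \<theta>1 - \<theta>4 / (real p * real q))"
    unfolding eq \<theta>1(3) \<theta>2(3) \<theta>3(3) \<theta>4(3) using pos by (simp add: field_simps)
  have b: "\<theta> / y \<le> 1" "0 \<le> \<theta> / y" if "0 \<le> \<theta>" "\<theta> \<le> 1" "y \<ge> 1" for \<theta> y :: real
    using that by (auto simp: field_simps)
  have pq: "real p * real q \<ge> 1"
    using mult_mono[of 1 "real p" 1 "real q"] pos by simp
  have e: "\<bar>\<theta>2 / q + \<theta>3 / p - \<theta>1 - \<theta>4 / (real p * real q)\<bar> \<le> 4"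
    using b[OF \<theta>2(1,2) pos(4)] b[OF \<theta>3(1,2) pos(3)] b[OF \<theta>4(1,2) pq] \<theta>1(1,2) by linarith
  show "\<bar>\<Sum>n = 1..nat \<lfloor>x\<rfloor>. (of_bool (p dvd n) - 1 / real p) * (of_bool (q dvd n) - 1 / real q)\<bar> \<le> 4"
    if "p \<noteq> q"
    unfolding eq2 using e that by (simp add: r_def)
  show "(\<Sum>n = 1..nat \<lfloor>x\<rfloor>. (of_bool (p dvd n) - 1 / real p) * (of_bool (q dvd n) - 1 / real q)) \<le> x / real p + 4"
    if "p = q"
  proof -
    have "x / (real p * real q) \<ge> 0" using assms(3) by simp
    then show ?thesis
      unfolding eq2 using e that by (simp add: r_def)
  qed
qed

text \<open>The dual form of the Turan--Kubilius inequality: the deviations \<open>c\<close> are themselves used as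
  coefficients in the variance of \<open>\<Sum>p. c p * of_bool (p dvd n)\<close>.\<close>

lemma dual_turan_kubilius:
  fixes b :: "nat \<Rightarrow> real"
  assumes P: "finite P" "\<forall>p\<in>P. prime p" and b: "\<forall>n. \<bar>b n\<bar> \<le> 1"
  shows "\<forall>\<^sub>F x in at_top. (\<Sum>p\<in>P. (1 / real p) *
    ((real p / x) * (\<Sum>n = 1..nat \<lfloor>x\<rfloor>. of_bool (p dvd n) * b n) - (\<Sum>n = 1..nat \<lfloor>x\<rfloor>. b n) / x)\<^sup>2) \<le> 2"
  using eventually_ge_at_top[of "max 1 (4 * (\<Sum>p\<in>P. real p + 1)\<^sup>2)"]
proof eventually_elim
  case (elim x)
  \<comment> \<open>This threshold absorbs the rounding errors of the correlations: they total at
    most four times the square of the sum of all \<open>\<bar>c p\<bar>\<close>, and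
    \<open>\<bar>c p\<bar> \<le> real p + 1\<close>.\<close>
  then have x: "x \<ge> 1" "4 * (\<Sum>p\<in>P. real p + 1)\<^sup>2 \<le> x" by auto
  define I where "I = {1..nat \<lfloor>x\<rfloor>}"
  define c where "c p = (real p / x) * (\<Sum>n\<in>I. of_bool (p dvd n) * b n) - (\<Sum>n\<in>I. b n) / x" for p
  define V where "V = (\<Sum>p\<in>P. (1 / real p) * (c p)\<^sup>2)"
  define G where "G n = (\<Sum>p\<in>P. c p * (of_bool (p dvd n) - 1 / real p))" for n
  have p0: "real p > 0" if "p \<in> P" for p
    using bspec[OF P(2) that] prime_gt_0_nat by simp
  have cI: "real (card I) \<le> x"
    using x by (simp add: I_def)
  \<comment> \<open>Duality: pairing \<open>b\<close> with \<open>G\<close> gives back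
    \<open>x * V\<close>. By Cauchy-Schwarz the square of this is at most \<open>x\<close> times the
    second moment of \<open>G\<close>, which is at most \<open>x * V + x\<close>; so
    \<open>V\<close> satisfies a quadratic inequality.\<close>
  have "x * V = (\<Sum>n\<in>I. b n * G n)"
  proof -
    have "(\<Sum>n\<in>I. b n * G n) = (\<Sum>p\<in>P. c p * (\<Sum>n\<in>I. (of_bool (p dvd n) - 1 / real p) * b n))"
      unfolding G_def sum_distrib_left by (subst sum.swap) (simp add: mult_ac)
    also have "\<dots> = (\<Sum>p\<in>P. x * ((1 / real p) * (c p)\<^sup>2))"
    proof (rule sum.cong[OF refl])
      fix p assume "p \<in> P"
      have "(\<Sum>n\<in>I. (of_bool (p dvd n) - 1 / real p) * b n)
          = (\<Sum>n\<in>I. of_bool (p dvd n) * b n) - (1 / real p) * (\<Sum>n\<in>I. b n)"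
        by (simp only: left_diff_distrib sum_subtractf sum_distrib_left)
      also have "\<dots> = x / real p * c p"
        using p0[OF \<open>p \<in> P\<close>] x by (simp add: c_def field_simps)
      finally show "c p * (\<Sum>n\<in>I. (of_bool (p dvd n) - 1 / real p) * b n) = x * ((1 / real p) * (c p)\<^sup>2)"
        by (simp add: power2_eq_square)
    qed
    also have "\<dots> = x * V"
      by (simp add: V_def sum_distrib_left)
    finally show ?thesis ..
  qed
  then have "(x * V)\<^sup>2 \<le> (\<Sum>n\<in>I. (b n)\<^sup>2) * (\<Sum>n\<in>I. (G n)\<^sup>2)"
    using Cauchy_Schwarz_ineq_sum[of b G I] by simp
  also have "\<dots> \<le> x * (\<Sum>n\<in>I. (G n)\<^sup>2)"
  proof (rule mult_right_mono)
    have "(\<Sum>n\<in>I. (b n)\<^sup>2) \<le> (\<Sum>n\<in>I. 1)"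
      using b by (intro sum_mono) (simp add: abs_square_le_1)
    then show "(\<Sum>n\<in>I. (b n)\<^sup>2) \<le> x"
      using cI by simp
  qed (simp add: sum_nonneg)
  also have "(\<Sum>n\<in>I. (G n)\<^sup>2) \<le> x * V + x"
  proof -
    define R where "R p q = (\<Sum>n\<in>I. (of_bool (p dvd n) - 1 / real p) * (of_bool (q dvd n) - 1 / real q))" for p q
    have cb: "\<bar>c p\<bar> \<le> real p + 1" if "p \<in> P" for p
    proof -
      have "\<bar>\<Sum>n\<in>I. of_bool (p dvd n) * b n\<bar> \<le> (\<Sum>n\<in>I. 1)"
        using b by (intro order_trans[OF sum_abs] sum_mono) (auto simp: abs_mult)
      then have 1: "\<bar>\<Sum>n\<in>I. of_bool (p dvd n) * b n\<bar> \<le> x" using cI by simp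
      have "\<bar>\<Sum>n\<in>I. b n\<bar> \<le> (\<Sum>n\<in>I. 1)"
        using b by (intro order_trans[OF sum_abs] sum_mono) auto
      then have 2: "\<bar>\<Sum>n\<in>I. b n\<bar> \<le> x" using cI by simp
      have "\<bar>c p\<bar> \<le> \<bar>(real p / x) * (\<Sum>n\<in>I. of_bool (p dvd n) * b n)\<bar> + \<bar>(\<Sum>n\<in>I. b n) / x\<bar>"
        unfolding c_def by (rule abs_triangle_ineq4)
      also have "\<dots> = (real p / x) * \<bar>\<Sum>n\<in>I. of_bool (p dvd n) * b n\<bar> + \<bar>\<Sum>n\<in>I. b n\<bar> / x"
        using x by (simp add: abs_mult)
      also have "\<dots> \<le> (real p / x) * x + x / x"
        using x 1 2 by (intro add_mono mult_left_mono divide_right_mono) auto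
      finally show ?thesis using x by simp
    qed
    have "(\<Sum>n\<in>I. (G n)\<^sup>2) = (\<Sum>p\<in>P. \<Sum>q\<in>P. c p * c q * R p q)"
    proof -
      have "(\<Sum>n\<in>I. (G n)\<^sup>2) = (\<Sum>n\<in>I. \<Sum>p\<in>P. \<Sum>q\<in>P. c p * c q *
          ((of_bool (p dvd n) - 1 / real p) * (of_bool (q dvd n) - 1 / real q)))"
        unfolding G_def power2_eq_square sum_product by (simp add: mult_ac)
      also have "\<dots> = (\<Sum>p\<in>P. \<Sum>q\<in>P. \<Sum>n\<in>I. c p * c q *
          ((of_bool (p dvd n) - 1 / real p) * (of_bool (q dvd n) - 1 / real q)))"
        by (subst sum.swap, rule sum.cong[OF refl], rule sum.swap)
      finally show ?thesis
        by (simp add: R_def sum_distrib_left)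
    qed
    \<comment> \<open>Only the diagonal has a main term, and summed over \<open>P\<close> it
      reproduces \<open>x * V\<close>.\<close>
    also have "\<dots> \<le> (\<Sum>p\<in>P. \<Sum>q\<in>P. (if q = p then (c p)\<^sup>2 * (x / real p) else 0) + \<bar>c p\<bar> * \<bar>c q\<bar> * 4)"
    proof (intro sum_mono)
      fix p q assume pq: "p \<in> P" "q \<in> P"
      note R = prime_indicator_correlation[OF bspec[OF P(2) pq(1)] bspec[OF P(2) pq(2)], of x, folded I_def, folded R_def]
      show "c p * c q * R p q \<le> (if q = p then (c p)\<^sup>2 * (x / real p) else 0) + \<bar>c p\<bar> * \<bar>c q\<bar> * 4"
      proof (cases "q = p")
        case True
        have "(c p)\<^sup>2 * R p q \<le> (c p)\<^sup>2 * (x / real p + 4)"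
          using R(2) True x by (intro mult_left_mono) auto
        then show ?thesis
          using True by (simp add: power2_eq_square algebra_simps flip: abs_mult)
      next
        case False
        have "c p * c q * R p q \<le> \<bar>c p * c q * R p q\<bar>" by simp
        also have "\<dots> = \<bar>c p\<bar> * \<bar>c q\<bar> * \<bar>R p q\<bar>" by (simp add: abs_mult)
        also have "\<dots> \<le> \<bar>c p\<bar> * \<bar>c q\<bar> * 4"
          using R(1) False x by (intro mult_left_mono) auto
        finally show ?thesis using False by simp
      qed
    qed
    also have "\<dots> = (\<Sum>p\<in>P. (c p)\<^sup>2 * (x / real p)) + (\<Sum>p\<in>P. \<bar>c p\<bar>) * (\<Sum>p\<in>P. \<bar>c p\<bar>) * 4"
    proof -
      have "(\<Sum>p\<in>P. \<Sum>q\<in>P. \<bar>c p\<bar> * \<bar>c q\<bar> * 4) = (\<Sum>p\<in>P. \<bar>c p\<bar>) * (\<Sum>p\<in>P. \<bar>c p\<bar>) * 4"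
        by (simp only: sum_product) (simp only: sum_distrib_right)
      then show ?thesis
        using P(1) by (simp only: sum.distrib sum.delta if_True cong: sum.cong)
    qed
    also have "(\<Sum>p\<in>P. (c p)\<^sup>2 * (x / real p)) = x * V"
      by (simp add: V_def sum_distrib_left mult_ac)
    also have "(\<Sum>p\<in>P. \<bar>c p\<bar>) * (\<Sum>p\<in>P. \<bar>c p\<bar>) * 4 \<le> (\<Sum>p\<in>P. real p + 1) * (\<Sum>p\<in>P. real p + 1) * 4"
      using cb by (intro mult_right_mono mult_mono sum_mono sum_nonneg) auto
    also have "\<dots> \<le> x"
      using x by (simp add: power2_eq_square mult_ac)
    finally show ?thesis by simp
  qed
  finally have "x\<^sup>2 * V\<^sup>2 \<le> x\<^sup>2 * (V + 1)"
    using x by (simp add: power_mult_distrib power2_eq_square algebra_simps)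
  then have "V\<^sup>2 \<le> V + 1"
    using x by simp
  have "V \<le> 2"
  proof (rule ccontr)
    assume "\<not> V \<le> 2"
    then have "V * V > 2 * V" by simp
    with \<open>V\<^sup>2 \<le> V + 1\<close> \<open>\<not> V \<le> 2\<close> show False by (simp add: power2_eq_square)
  qed
  then show ?case
    by (simp add: V_def c_def I_def)
qed

section \<open>From multiples of a prime to the shifted sequence\<close>

lemma omega_prime_mult:
  assumes "prime p" "m > 0"
  shows "omega (p * m) = (if p dvd m then omega m else Suc (omega m))"
proof -
  have "prime_factors (p * m) = insert p (prime_factors m)"
  proof (rule set_eqI)
    fix q
    have "p * m \<noteq> 0"
      using assms prime_gt_0_nat[of p] by simp
    then have "q \<in> prime_factors (p * m) \<longleftrightarrow> prime q \<and> (q dvd p \<or> q dvd m)"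
      by (metis in_prime_factors_iff prime_dvd_mult_iff)
    also have "\<dots> \<longleftrightarrow> q = p \<or> prime q \<and> q dvd m"
    proof -
      have "prime q \<and> q dvd p \<longleftrightarrow> q = p"
        using assms(1) primes_dvd_imp_eq[of q p] by auto
      then show ?thesis by blast
    qed
    also have "\<dots> \<longleftrightarrow> q \<in> insert p (prime_factors m)"
      using assms(2) by (auto simp: in_prime_factors_iff)
    finally show "q \<in> prime_factors (p * m) \<longleftrightarrow> q \<in> insert p (prime_factors m)" .
  qed
  moreover have "p \<in> prime_factors m \<longleftrightarrow> p dvd m"
    using assms by (auto simp: prime_factors_dvd)
  ultimately show ?thesis
    by (simp add: omega_def card_insert_if)
qed

text \<open>A multiple \<open>p * m\<close> has one more prime factor than \<open>m\<close> unless
  \<open>p\<close> divides \<open>m\<close>. So the mean over multiples of \<open>p\<close> is the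
  shifted average at \<open>x / p\<close>, up to an error of \<open>2 / p\<close> from the
  exceptional \<open>m\<close>. The squared errors are summable, and 20 arises as
  \<open>2 * 2 + 8 * 2\<close>.\<close>

lemma omega_avg_shift_square_sum:
  fixes a :: "nat \<Rightarrow> real"
  assumes P: "finite P" "\<forall>p\<in>P. prime p" and a: "\<And>n. \<bar>a n\<bar> \<le> 1"
  shows "\<forall>\<^sub>F x in at_top. (\<Sum>p\<in>P. (1 / real p) *
    (omega_avg (a \<circ> Suc) (x / real p) - omega_avg a x)\<^sup>2) \<le> 20"
  using dual_turan_kubilius[of P "\<lambda>n. a (omega n)", OF P allI[OF a]] eventually_gt_at_top[of 0]
proof eventually_elim
  case (elim x)
  define c where "c p = (real p / x) * (\<Sum>n = 1..nat \<lfloor>x\<rfloor>. of_bool (p dvd n) * a (omega n)) - omega_avg a x" for p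
  define e where "e p = omega_avg (a \<circ> Suc) (x / real p) - omega_avg a x" for p
  have p0: "real p > 0" if "p \<in> P" for p
    using bspec[OF P(2) that] prime_gt_0_nat by simp
  have diff: "\<bar>e p - c p\<bar> \<le> 2 / real p" if "p \<in> P" for p
  proof -
    define J where "J = {1..nat \<lfloor>x / real p\<rfloor>}"
    have p: "prime p" "p > 0" "real p > 0" using bspec[OF P(2) that] prime_gt_0_nat by auto
    have a2: "\<bar>a i - a j\<bar> \<le> 2" for i j
      using a[of i] a[of j] by linarith
    have "e p - c p = (real p / x) * ((\<Sum>m\<in>J. a (Suc (omega m))) - (\<Sum>m\<in>J. a (omega (p * m))))"
      unfolding e_def c_def using p elim(2)
      by (subst sum_multiples_upto) (auto simp: omega_avg_def J_def algebra_simps)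
    also have "(\<Sum>m\<in>J. a (Suc (omega m))) - (\<Sum>m\<in>J. a (omega (p * m)))
        = (\<Sum>m\<in>J. of_bool (p dvd m) * (a (Suc (omega m)) - a (omega m)))"
      unfolding sum_subtractf[symmetric]
      by (rule sum.cong) (auto simp: J_def omega_prime_mult[OF p(1)])
    finally have "\<bar>e p - c p\<bar> = (real p / x) * \<bar>\<Sum>m\<in>J. of_bool (p dvd m) * (a (Suc (omega m)) - a (omega m))\<bar>"
      using elim(2) p by (simp add: abs_mult)
    also have "\<dots> \<le> (real p / x) * (2 * (x / real p / real p))"
    proof (intro mult_left_mono)
      have "\<bar>\<Sum>m\<in>J. of_bool (p dvd m) * (a (Suc (omega m)) - a (omega m))\<bar> \<le> (\<Sum>m\<in>J. 2 * of_bool (p dvd m))"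
        using a2 by (intro order_trans[OF sum_abs] sum_mono) (auto simp: abs_mult)
      also have "\<dots> = 2 * (\<Sum>m\<in>J. of_bool (p dvd m))"
        by (simp only: sum_distrib_left)
      also have "(\<Sum>m\<in>J. of_bool (p dvd m) :: real) \<le> x / real p / real p"
      proof -
        have "x / real p \<ge> 0" using elim(2) p by simp
        from count_multiples_upto[OF p(2) this] show ?thesis
          unfolding J_def by (metis add_le_cancel_left add.right_neutral diff_add_cancel le_add_same_cancel1)
      qed
      finally show "\<bar>\<Sum>m\<in>J. of_bool (p dvd m) * (a (Suc (omega m)) - a (omega m))\<bar> \<le> 2 * (x / real p / real p)"
        by simp
    qed (use p elim(2) in auto)
    also have "\<dots> = 2 / real p" using elim(2) p by simp
    finally show ?thesis .
  qed
  have "(\<Sum>p\<in>P. (1 / real p) * (e p)\<^sup>2) \<le> (\<Sum>p\<in>P. 2 * ((1 / real p) * (c p)\<^sup>2) + 8 * (1 / real p ^ 2))"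
  proof (rule sum_mono)
    fix p assume p: "p \<in> P"
    have "real p \<ge> 1" using p0[OF p] by simp
    have "(e p - c p)\<^sup>2 \<le> (2 / real p)\<^sup>2"
      using diff[OF p] by (rule abs_le_square_iff[THEN iffD1, OF order_trans]) simp
    moreover have "(e p)\<^sup>2 \<le> 2 * (c p)\<^sup>2 + 2 * (e p - c p)\<^sup>2"
      using sum_squares_ge_zero[of "e p - 2 * c p" 0] by (simp add: power2_eq_square algebra_simps)
    ultimately have "(e p)\<^sup>2 \<le> 2 * (c p)\<^sup>2 + 2 * (2 / real p)\<^sup>2" by linarith
    then have "(1 / real p) * (e p)\<^sup>2 \<le> (1 / real p) * (2 * (c p)\<^sup>2 + 2 * (2 / real p)\<^sup>2)"
      by (intro mult_left_mono) auto
    also have "\<dots> = 2 * ((1 / real p) * (c p)\<^sup>2) + (1 / real p) * (8 / real p ^ 2)"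
      by (simp add: algebra_simps power_divide)
    also have "(1 / real p) * (8 / real p ^ 2) \<le> 1 * (8 / real p ^ 2)"
      using \<open>real p \<ge> 1\<close> by (intro mult_right_mono) auto
    finally show "(1 / real p) * (e p)\<^sup>2 \<le> 2 * ((1 / real p) * (c p)\<^sup>2) + 8 * (1 / real p ^ 2)"
      by simp
  qed
  also have "\<dots> = 2 * (\<Sum>p\<in>P. (1 / real p) * (c p)\<^sup>2) + 8 * (\<Sum>p\<in>P. 1 / real p ^ 2)"
    by (simp add: sum.distrib sum_distrib_left)
  also have "(\<Sum>p\<in>P. (1 / real p) * (c p)\<^sup>2) \<le> 2"
    using elim(1) by (simp add: c_def omega_avg_def)
  also have "(\<Sum>p\<in>P. 1 / real p ^ 2) \<le> 2"
  proof -
    have "P \<subseteq> {1..Max (insert 0 P)}"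
      using P(1) p0 by (auto simp: Suc_le_eq)
    then have "(\<Sum>p\<in>P. 1 / real p ^ 2) \<le> (\<Sum>p = 1..Max (insert 0 P). 1 / real p ^ 2)"
      by (intro sum_mono2) auto
    also have "\<dots> \<le> 2" by (rule sum_inverse_squares_le)
    finally show ?thesis .
  qed
  finally show ?case
    by (simp add: e_def)
qed

text \<open>For \<open>x \<le> y\<close>, both the change of the divisor and the added terms cost at
  most \<open>1 - x / y\<close>, which is at most \<open>ln y - ln x\<close>. The terms
  \<open>1 / x\<close> and \<open>1 / y\<close> pay for the floors.\<close>

lemma omega_avg_lipschitz:
  fixes a :: "nat \<Rightarrow> real"
  assumes a: "\<And>n. \<bar>a n\<bar> \<le> 1" and x: "0 < x" and y: "0 < y" and xy: "\<bar>ln x - ln y\<bar> \<le> r"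
  shows "\<bar>omega_avg a x - omega_avg a y\<bar> \<le> 2 * r + 1 / x + 1 / y"
proof -
  have main: "\<bar>omega_avg a x - omega_avg a y\<bar> \<le> 2 * (ln y - ln x) + 1 / y" if "0 < x" "x \<le> y" for x y
  proof -
    define S where "S z = (\<Sum>n = 1..nat \<lfloor>z\<rfloor>. a (omega n))" for z :: real
    have bound: "\<bar>\<Sum>n\<in>I. a (omega n)\<bar> \<le> real (card I)" for I
      using sum_mono[of I "\<lambda>n. \<bar>a (omega n)\<bar>" "\<lambda>_. 1"] a
      by (intro order_trans[OF sum_abs]) simp
    have fl: "real (nat \<lfloor>z\<rfloor>) \<le> z" "z \<le> real (nat \<lfloor>z\<rfloor>) + 1" if "z > 0" for z :: real
      using that by linarith+
    have "\<bar>S x\<bar> \<le> x"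
      unfolding S_def using that by (intro order_trans[OF bound]) simp
    have "nat \<lfloor>x\<rfloor> \<le> nat \<lfloor>y\<rfloor>" using that by (intro nat_mono floor_mono)
    then have "{1..nat \<lfloor>y\<rfloor>} = {1..nat \<lfloor>x\<rfloor>} \<union> {nat \<lfloor>x\<rfloor> + 1..nat \<lfloor>y\<rfloor>}" by auto
    then have "S y = S x + (\<Sum>n = nat \<lfloor>x\<rfloor> + 1..nat \<lfloor>y\<rfloor>. a (omega n))"
      unfolding S_def by (simp add: sum.union_disjoint)
    then have "\<bar>S y - S x\<bar> \<le> real (nat \<lfloor>y\<rfloor>) - real (nat \<lfloor>x\<rfloor>)"
      using bound[of "{nat \<lfloor>x\<rfloor> + 1..nat \<lfloor>y\<rfloor>}"] \<open>nat \<lfloor>x\<rfloor> \<le> nat \<lfloor>y\<rfloor>\<close> by (simp add: of_nat_diff)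
    then have Sd: "\<bar>S y - S x\<bar> \<le> y - x + 1"
      using fl[of x] fl[of y] that by linarith
    have "omega_avg a x - omega_avg a y = S x * (1 / x - 1 / y) - (S y - S x) / y"
      using that by (simp add: omega_avg_def S_def field_simps)
    also have "\<bar>\<dots>\<bar> \<le> \<bar>S x * (1 / x - 1 / y)\<bar> + \<bar>(S y - S x) / y\<bar>"
      by (rule abs_triangle_ineq4)
    also have "\<bar>S x * (1 / x - 1 / y)\<bar> = \<bar>S x\<bar> * (1 / x - 1 / y)"
      using that by (simp add: abs_mult frac_le)
    also have "\<dots> \<le> x * (1 / x - 1 / y)"
      using \<open>\<bar>S x\<bar> \<le> x\<close> that by (intro mult_right_mono) (auto simp: field_simps)
    also have "\<bar>(S y - S x) / y\<bar> \<le> (y - x + 1) / y"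
      using Sd that by (simp add: divide_right_mono)
    also have "x * (1 / x - 1 / y) + (y - x + 1) / y = 2 * (1 - x / y) + 1 / y"
      using that by (simp add: field_simps)
    finally have "\<bar>omega_avg a x - omega_avg a y\<bar> \<le> 2 * (1 - x / y) + 1 / y"
      by simp
    moreover have "ln (x / y) \<le> x / y - 1"
      using that by (intro ln_le_minus_one) auto
    ultimately show ?thesis
      using that by (simp add: ln_div)
  qed
  have "1 / x > 0" "1 / y > 0" using x y by auto
  moreover have "ln y - ln x \<le> r" "ln x - ln y \<le> r" using xy by auto
  ultimately show ?thesis
  proof (cases "x \<le> y")
    case True
    then show ?thesis using main[OF x True] \<open>1 / x > 0\<close> \<open>ln y - ln x \<le> r\<close> by argo
  next
    case False
    then show ?thesis using main[OF y, of x] \<open>1 / y > 0\<close> \<open>ln x - ln y \<le> r\<close>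
      unfolding abs_minus_commute[of "omega_avg a x"] by argo
  qed
qed

section \<open>Slow variation of averages\<close>

text \<open>The cells have equal length on the scale of \<open>ln p\<close>, so primes from cells
  \<open>k\<close> and \<open>k + d\<close> have a quotient that is \<open>exp (d * \<rho>)\<close>
  up to a factor between \<open>exp (- \<rho>)\<close> and \<open>exp \<rho>\<close>.\<close>

definition prime_cell :: "real \<Rightarrow> nat \<Rightarrow> nat set" where
  "prime_cell \<rho> k = {p. prime p \<and> real k * \<rho> \<le> ln (real p) \<and> ln (real p) < (real k + 1) * \<rho>}"

definition cell_mass :: "real \<Rightarrow> nat \<Rightarrow> real" where
  "cell_mass \<rho> k = (\<Sum>p\<in>prime_cell \<rho> k. 1 / real p)"

lemma finite_primes_ln_less: "finite {p::nat. prime p \<and> ln (real p) < u}"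
proof (rule finite_subset)
  show "{p. prime p \<and> ln (real p) < u} \<subseteq> {..nat \<lceil>exp u\<rceil>}"
  proof
    fix p assume "p \<in> {p. prime p \<and> ln (real p) < u}"
    then have "real p > 0" "ln (real p) < u" using prime_gt_0_nat by auto
    then have "real p < exp u" by (metis exp_ln exp_less_cancel_iff)
    then show "p \<in> {..nat \<lceil>exp u\<rceil>}" by (simp, linarith)
  qed
qed auto

lemma finite_prime_cell [simp]: "finite (prime_cell \<rho> k)"
  by (rule finite_subset[OF _ finite_primes_ln_less[of "(real k + 1) * \<rho>"]]) (auto simp: prime_cell_def)

lemma cell_mass_nonneg: "cell_mass \<rho> k \<ge> 0"
  by (auto simp: cell_mass_def intro: sum_nonneg)

lemma prime_cell_disjoint:
  assumes "\<rho> > 0" "j \<noteq> k"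
  shows "prime_cell \<rho> j \<inter> prime_cell \<rho> k = {}"
proof -
  have "p \<notin> prime_cell \<rho> k" if "p \<in> prime_cell \<rho> j" "j < k" for p j k
  proof
    assume "p \<in> prime_cell \<rho> k"
    have "(real j + 1) * \<rho> \<le> real k * \<rho>"
      using that assms(1) by (intro mult_right_mono) auto
    with that(1) \<open>p \<in> prime_cell \<rho> k\<close> show False
      by (auto simp: prime_cell_def)
  qed
  then show ?thesis
    using assms(2) by (metis disjoint_iff linorder_neqE_nat)
qed

lemma sum_cells:
  assumes "\<rho> > 0" "finite I"
  shows "(\<Sum>k\<in>I. \<Sum>p\<in>prime_cell \<rho> k. g p) = (\<Sum>p\<in>(\<Union>k\<in>I. prime_cell \<rho> k). g p)"
  using assms by (subst sum.UNION_disjoint) (auto simp: prime_cell_disjoint)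

lemma prime_cells_union:
  assumes "\<rho> > 0"
  shows "(\<Union>k<n. prime_cell \<rho> k) = {p. prime p \<and> ln (real p) < real n * \<rho>}"
proof (intro equalityI subsetI)
  fix p assume "p \<in> (\<Union>k<n. prime_cell \<rho> k)"
  then obtain k where k: "k < n" "p \<in> prime_cell \<rho> k" by auto
  then have "(real k + 1) * \<rho> \<le> real n * \<rho>"
    using assms by (intro mult_right_mono) auto
  with k show "p \<in> {p. prime p \<and> ln (real p) < real n * \<rho>}"
    by (auto simp: prime_cell_def)
next
  fix p assume "p \<in> {p. prime p \<and> ln (real p) < real n * \<rho>}"
  then have p: "prime p" "ln (real p) < real n * \<rho>" by auto
  have "ln (real p) \<ge> 0" using prime_gt_0_nat[OF p(1)] by (simp add: Suc_le_eq)
  define k where "k = nat \<lfloor>ln (real p) / \<rho>\<rfloor>"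
  have "ln (real p) / \<rho> \<ge> 0" using \<open>ln (real p) \<ge> 0\<close> assms by simp
  then have "real k \<le> ln (real p) / \<rho>" "ln (real p) / \<rho> < real k + 1"
    unfolding k_def by linarith+
  then have k: "real k * \<rho> \<le> ln (real p)" "ln (real p) < (real k + 1) * \<rho>"
    using assms by (simp_all add: field_simps)
  have "real k * \<rho> < real n * \<rho>" using k p by linarith
  then have "k < n" using assms by simp
  then show "p \<in> (\<Union>k<n. prime_cell \<rho> k)"
    using k p by (auto simp: prime_cell_def)
qed

lemma sum_cell_mass_ge:
  assumes "\<rho> > 0" "real n * \<rho> \<ge> 2"
  shows "(\<Sum>k<n. cell_mass \<rho> k) \<ge> ln (real n * \<rho> - ln 2) - ln 2"
proof -
  define u where "u = real n * \<rho>"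
  \<comment> \<open>Halving keeps the primes up to \<open>N\<close> strictly below
    \<open>exp u\<close>, as the half-open cells demand; the cost is the \<open>ln 2\<close> inside
    the outer logarithm.\<close>
  define N where "N = nat \<lfloor>exp u / 2\<rfloor>"
  have eu: "exp u \<ge> 2" using assms exp_ge_add_one_self[of u] unfolding u_def by linarith
  have N: "real N \<le> exp u / 2" "exp u / 2 \<le> real N + 1" "N \<ge> 1"
    unfolding N_def using eu by (linarith, linarith, simp add: le_nat_floor_iff)
  have "ln 2 < u" using assms ln_less_self[of "2::real"] unfolding u_def by linarith
  have "u - ln 2 = ln (exp u / 2)" by (simp add: ln_div)
  also have "\<dots> \<le> ln (real N + 1)" using N by (subst ln_le_cancel_iff) auto
  finally have "ln (u - ln 2) - ln 2 \<le> ln (ln (real N + 1)) - ln 2"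
    using \<open>ln 2 < u\<close> by (intro diff_right_mono ln_mono) auto
  also have "\<dots> \<le> (\<Sum>p | prime p \<and> p \<le> N. 1 / real p)"
    using N by (intro sum_inverse_primes_ge)
  also have "\<dots> \<le> (\<Sum>p | prime p \<and> ln (real p) < u. 1 / real p)"
  proof (rule sum_mono2[OF finite_primes_ln_less])
    show "{p. prime p \<and> p \<le> N} \<subseteq> {p. prime p \<and> ln (real p) < u}"
    proof clarify
      fix p :: nat assume p: "prime p" "p \<le> N"
      have "real p < exp u" using p(2) N(1) eu by linarith
      then have "ln (real p) < ln (exp u)"
        using prime_gt_0_nat[OF p(1)] by (subst ln_less_cancel_iff) auto
      then show "ln (real p) < u" by simp
    qed
  qed auto
  also have "\<dots> = (\<Sum>k<n. cell_mass \<rho> k)"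
    unfolding cell_mass_def using assms(1) by (simp add: sum_cells prime_cells_union u_def)
  finally show ?thesis by (simp add: u_def)
qed

lemma harm_le: "n \<ge> 1 \<Longrightarrow> (harm n :: real) \<le> 1 + ln (real n)"
  using decseqD[OF decseq_harm_diff_ln, of 0 "n - 1"] by (simp add: harm_def)

text \<open>Passes from cells to an interval of primes, where the short interval bound
  applies.\<close>

lemma cells_near:
  assumes "\<rho> > 0" "finite J" "\<And>k. k \<in> J \<Longrightarrow> u \<le> real k * \<rho> \<and> (real k + 1) * \<rho> \<le> v"
  shows "(\<Sum>k\<in>J. cell_mass \<rho> k) \<le> (\<Sum>p | prime p \<and> exp u \<le> real p \<and> real p \<le> exp v. 1 / real p)"
proof -
  have "(\<Sum>k\<in>J. cell_mass \<rho> k) = (\<Sum>p\<in>(\<Union>k\<in>J. prime_cell \<rho> k). 1 / real p)"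
    unfolding cell_mass_def using assms by (intro sum_cells) auto
  also have "\<dots> \<le> (\<Sum>p | prime p \<and> exp u \<le> real p \<and> real p \<le> exp v. 1 / real p)"
  proof (rule sum_mono2)
    show "finite {p. prime p \<and> exp u \<le> real p \<and> real p \<le> exp v}"
      by (rule finite_subset[of _ "{..nat \<lceil>exp v\<rceil>}"]) (auto, linarith)
    show "(\<Union>k\<in>J. prime_cell \<rho> k) \<subseteq> {p. prime p \<and> exp u \<le> real p \<and> real p \<le> exp v}"
    proof clarify
      fix k p assume "k \<in> J" "p \<in> prime_cell \<rho> k"
      then have "prime p" "u \<le> ln (real p)" "ln (real p) \<le> v"
        using assms(3)[of k] by (auto simp: prime_cell_def)
      moreover have "real p > 0" using \<open>prime p\<close> prime_gt_0_nat by simp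
      ultimately show "prime p \<and> exp u \<le> real p \<and> real p \<le> exp v"
        by (metis exp_le_cancel_iff exp_ln)
    qed
  qed auto
  finally show ?thesis .
qed

text \<open>Otherwise nearly all primes of a window of length \<open>\<epsilon>\<close> (in terms of \<open>ln p\<close>) would lie in one
  short interval, and the sum of their inverses would be too small compared with Euler's bound.\<close>

lemma paired_cells:
  assumes "\<epsilon> > 0"
  obtains \<delta> where "\<delta> > 0"
    "\<And>M. M > 0 \<Longrightarrow> \<epsilon> / real M \<le> \<delta> \<Longrightarrow> \<exists>d. \<delta> \<le> real d * (\<epsilon> / real M) \<and> real d * (\<epsilon> / real M) \<le> \<epsilon> \<and>
      \<not> summable (\<lambda>k. min (cell_mass (\<epsilon> / real M) k) (cell_mass (\<epsilon> / real M) (k + d)))"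
proof -
  have "\<epsilon> / 4 > 0" using assms by simp
  \<comment> \<open>With the constant \<open>\<epsilon> / 4\<close>, a short interval in the
    \<open>n\<close>-th window has mass at most \<open>(1/4) / n\<close>. Summed over windows this
    is a quarter of a logarithm, whereas Euler's bound gives a full one.\<close>
  then obtain \<eta> y0 :: real where \<eta>: "\<eta> > 0" and y0: "y0 \<ge> 2"
    "\<And>y. y \<ge> y0 \<Longrightarrow> (\<Sum>p | prime p \<and> y \<le> real p \<and> real p \<le> (1 + \<eta>) * y. 1 / real p) \<le> (\<epsilon> / 4) / ln y"
    using sum_inverse_primes_short_interval by blast
  \<comment> \<open>Cells within \<open>\<delta>\<close> of a given cell, each of length
    \<open>\<rho> \<le> \<delta>\<close>, span at most \<open>3 * \<delta>\<close>, that is, a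
    factor of \<open>1 + \<eta>\<close> in \<open>p\<close>.\<close>
  define \<delta> where "\<delta> = ln (1 + \<eta>) / 3"
  have "\<delta> > 0" using \<eta> by (simp add: \<delta>_def)
  have e3: "exp (u + 3 * \<delta>) = (1 + \<eta>) * exp u" for u
    using \<eta> by (simp add: \<delta>_def exp_add)
  show ?thesis
  proof
    show "\<delta> > 0" by fact
    fix M :: nat assume M: "M > 0" "\<epsilon> / real M \<le> \<delta>"
    define \<rho> where "\<rho> = \<epsilon> / real M"
    have \<rho>: "\<rho> > 0" "\<rho> \<le> \<delta>" "real M * \<rho> = \<epsilon>"
      using M assms by (auto simp: \<rho>_def)
    define m where "m = cell_mass \<rho>"
    have m0: "m k \<ge> 0" for k by (simp add: m_def cell_mass_nonneg)
    define D where "D = {d. \<delta> \<le> real d * \<rho> \<and> d < M}"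
    have "finite D" by (rule finite_subset[of _ "{..<M}"]) (auto simp: D_def)
    have "\<exists>d\<in>D. \<not> summable (\<lambda>k. min (m k) (m (k + d)))"
    proof (rule ccontr)
      assume "\<not> ?thesis"
      then have sm: "summable (\<lambda>k. min (m k) (m (k + d)))" if "d \<in> D" for d
        using that by blast
      define t where "t k = (\<Sum>d\<in>D. min (m k) (m (k + d)))" for k
      have t0: "t k \<ge> 0" for k using m0 by (auto simp: t_def intro: sum_nonneg)
      have smt: "summable t"
        unfolding t_def by (rule summable_sum) (rule sm)
      \<comment> \<open>The cells of \<open>W n\<close> make up the window of \<open>ln p\<close>
        from \<open>n * \<epsilon>\<close> to \<open>(n + 1) * \<epsilon>\<close>.\<close>
      define W where "W n = {n * M..<n * M + M}" for n
      have window: "(\<Sum>k\<in>W n. m k) \<le> (1/4) / real n + real M * (\<Sum>k\<in>W n. t k)"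
        if n: "n > 0" "ln y0 \<le> real n * \<epsilon>" for n
      proof -
        have W: "finite (W n)" "W n \<noteq> {}" "card (W n) = M" using M by (auto simp: W_def)
        obtain i where i: "i \<in> W n" "\<And>k. k \<in> W n \<Longrightarrow> m k \<le> m i"
          using finite_has_maximal[of "m ` W n"] W by (auto, metis nle_le)
        define near where "near = {k \<in> W n. \<bar>real k - real i\<bar> * \<rho> < \<delta>}"
        \<comment> \<open>The first entry puts \<open>exp u\<close> beyond \<open>y0\<close> and
          yields the factor \<open>1 / n\<close>; the second keeps the near cells below
          \<open>u + 3 * \<delta>\<close>.\<close>
        define u where "u = max (real n * \<epsilon>) (real i * \<rho> - \<delta>)"
        have "real n * \<epsilon> > 0" using n assms by simp
        have "(\<Sum>k\<in>near. m k) \<le> (\<Sum>p | prime p \<and> exp u \<le> real p \<and> real p \<le> exp (u + 3 * \<delta>). 1 / real p)"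
          unfolding m_def
        proof (rule cells_near[OF \<rho>(1)])
          show "finite near" using W by (simp add: near_def)
          fix k assume k: "k \<in> near"
          have "real k \<ge> real (n * M)" using k unfolding near_def W_def by (intro of_nat_mono) auto
          then have "real k * \<rho> \<ge> real (n * M) * \<rho>" using \<rho> by (intro mult_right_mono) auto
          also have "real (n * M) * \<rho> = real n * \<epsilon>" using \<rho>(3) by (simp add: mult.assoc)
          finally have 1: "real n * \<epsilon> \<le> real k * \<rho>" .
          have "\<bar>real k * \<rho> - real i * \<rho>\<bar> < \<delta>"
            using k \<rho>(1) by (simp add: near_def abs_mult flip: left_diff_distrib)
          moreover have "(real k + 1) * \<rho> = real k * \<rho> + \<rho>" by (simp add: distrib_right)
          ultimately show "u \<le> real k * \<rho> \<and> (real k + 1) * \<rho> \<le> u + 3 * \<delta>"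
            using 1 \<rho>(2) unfolding u_def by linarith
        qed
        also have "\<dots> \<le> (\<epsilon> / 4) / ln (exp u)"
        proof -
          have "y0 \<le> exp (real n * \<epsilon>)"
            using n(2) y0(1) by (metis exp_le_cancel_iff exp_ln less_le_trans zero_less_numeral)
          also have "\<dots> \<le> exp u" by (simp add: u_def)
          finally show ?thesis unfolding e3 by (rule y0(2))
        qed
        also have "\<dots> \<le> (\<epsilon> / 4) / (real n * \<epsilon>)"
          using \<open>real n * \<epsilon> > 0\<close> assms unfolding ln_exp by (intro divide_left_mono) (auto simp: u_def)
        also have "\<dots> = (1/4) / real n" using assms by simp
        finally have 1: "(\<Sum>k\<in>near. m k) \<le> (1/4) / real n" .
        \<comment> \<open>As \<open>m i\<close> is maximal in the window, \<open>m k\<close> is the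
          minimum of the two masses. Their distance belongs to \<open>D\<close>, so this minimum is
          one of the terms of \<open>t\<close> at the smaller index.\<close>
        have far: "m k \<le> (\<Sum>k\<in>W n. t k)" if "k \<in> W n - near" for k
        proof -
          have k: "k \<in> W n" "\<bar>real k - real i\<bar> * \<rho> \<ge> \<delta>" using that by (auto simp: near_def)
          have "\<exists>j\<in>W n. m k \<le> t j"
          proof (cases "k \<ge> i")
            case True
            then have "k - i \<in> D" using k i(1) by (auto simp: D_def W_def of_nat_diff)
            then have "min (m i) (m (i + (k - i))) \<le> t i"
              unfolding t_def using \<open>finite D\<close> m0 by (intro member_le_sum) auto
            then show ?thesis using True i k by (intro bexI[of _ i]) (auto simp: min_absorb2)
          next
            case False
            then have "i - k \<in> D" using k i(1) by (auto simp: D_def W_def of_nat_diff)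
            then have "min (m k) (m (k + (i - k))) \<le> t k"
              unfolding t_def using \<open>finite D\<close> m0 by (intro member_le_sum) auto
            then show ?thesis using False i k by (intro bexI[of _ k]) (auto simp: min_absorb1)
          qed
          then obtain j where "j \<in> W n" "m k \<le> t j" by blast
          moreover have "t j \<le> (\<Sum>k\<in>W n. t k)"
            using \<open>j \<in> W n\<close> W t0 by (intro member_le_sum) auto
          ultimately show ?thesis by linarith
        qed
        have "(\<Sum>k\<in>W n. m k) = (\<Sum>k\<in>near. m k) + (\<Sum>k\<in>W n - near. m k)"
          using W by (subst sum.subset_diff[of near]) (auto simp: near_def)
        also have "(\<Sum>k\<in>W n - near. m k) \<le> (\<Sum>k\<in>W n - near. \<Sum>k\<in>W n. t k)"
          by (intro sum_mono far)
        also have "\<dots> \<le> real M * (\<Sum>k\<in>W n. t k)"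
          using W t0 card_mono[of "W n" "W n - near"]
          by (simp, intro mult_right_mono) (auto intro: sum_nonneg)
        finally show ?thesis using 1 by linarith
      qed
      have blocks: "(\<Sum>n<X. \<Sum>k\<in>W n. g k) = (\<Sum>k<X * M. g k)" for g :: "nat \<Rightarrow> real" and X
        unfolding W_def by (induction X) (simp_all add: sum.lessThan_Suc lessThan_atLeast0
            sum.atLeastLessThan_concat add.commute)
      obtain n0 where n0: "real n0 * \<epsilon> \<ge> ln y0" "n0 > 0"
      proof -
        obtain n where "real n * \<epsilon> \<ge> ln y0"
          using reals_Archimedean3[OF assms] by (metis less_imp_le)
        moreover have "real n * \<epsilon> \<le> real (Suc n) * \<epsilon>" using assms by (intro mult_right_mono) auto
        ultimately show ?thesis using that[of "Suc n"] by linarith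
      qed
      define C where "C = (\<Sum>n<n0. \<Sum>k\<in>W n. m k) + real M * suminf t"
      have upper: "(\<Sum>k<X * M. m k) \<le> C + (1/4) * (1 + ln (real X))" if X: "X \<ge> n0" for X
      proof -
        have "(\<Sum>k<X * M. m k) = (\<Sum>n<X. \<Sum>k\<in>W n. m k)" by (simp add: blocks)
        also have "\<dots> = (\<Sum>n<n0. \<Sum>k\<in>W n. m k) + (\<Sum>n\<in>{n0..<X}. \<Sum>k\<in>W n. m k)"
          using X by (simp add: lessThan_atLeast0 sum.atLeastLessThan_concat)
        also have "(\<Sum>n\<in>{n0..<X}. \<Sum>k\<in>W n. m k)
            \<le> (\<Sum>n\<in>{n0..<X}. (1/4) / real n + real M * (\<Sum>k\<in>W n. t k))"
        proof (rule sum_mono)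
          fix n assume "n \<in> {n0..<X}"
          then have "n0 \<le> n" by simp
          then have "real n0 * \<epsilon> \<le> real n * \<epsilon>" using assms by (intro mult_right_mono) auto
          then show "(\<Sum>k\<in>W n. m k) \<le> (1/4) / real n + real M * (\<Sum>k\<in>W n. t k)"
            using \<open>n0 \<le> n\<close> n0 by (intro window) auto
        qed
        also have "\<dots> = (1/4) * (\<Sum>n\<in>{n0..<X}. 1 / real n) + real M * (\<Sum>n\<in>{n0..<X}. \<Sum>k\<in>W n. t k)"
          by (simp add: sum.distrib sum_distrib_left)
        also have "\<dots> \<le> (1/4) * (1 + ln (real X)) + real M * suminf t"
        proof (intro add_mono mult_left_mono)
          have "(\<Sum>n\<in>{n0..<X}. 1 / real n) \<le> (\<Sum>n\<in>{1..X}. 1 / real n)"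
            using n0 by (intro sum_mono2) auto
          also have "\<dots> = harm X" by (simp add: harm_def inverse_eq_divide)
          also have "\<dots> \<le> 1 + ln (real X)" using n0 X by (intro harm_le) auto
          finally show "(\<Sum>n\<in>{n0..<X}. 1 / real n) \<le> 1 + ln (real X)" .
          have "(\<Sum>n\<in>{n0..<X}. \<Sum>k\<in>W n. t k) \<le> (\<Sum>n<X. \<Sum>k\<in>W n. t k)"
            using t0 by (intro sum_mono2) (auto intro: sum_nonneg)
          also have "\<dots> = (\<Sum>k<X * M. t k)" by (simp add: blocks)
          also have "\<dots> \<le> suminf t" using smt t0 by (intro sum_le_suminf) auto
          finally show "(\<Sum>n\<in>{n0..<X}. \<Sum>k\<in>W n. t k) \<le> suminf t" .
        qed auto
        finally show ?thesis by (simp add: C_def)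
      qed
      \<comment> \<open>The lower bound for the mass of \<open>X\<close> windows grows like
        \<open>ln X\<close>, the upper bound only like a quarter of it.\<close>
      have "filterlim (\<lambda>X::nat. ln (real X * \<epsilon> - ln 2) - ln 2 - (1/4) * (1 + ln (real X))) at_top sequentially"
        using assms by real_asymp
      then have "\<forall>\<^sub>F X in sequentially. ln (real X * \<epsilon> - ln 2) - ln 2 - (1/4) * (1 + ln (real X)) > C"
        unfolding filterlim_at_top_dense by blast
      moreover have "\<forall>\<^sub>F X::nat in sequentially. real X * \<epsilon> \<ge> 2"
        using assms by real_asymp
      ultimately have "\<forall>\<^sub>F X in sequentially. False"
        using eventually_ge_at_top[of n0]
      proof eventually_elim
        case (elim X)
        have eq: "real (X * M) * \<rho> = real X * \<epsilon>" using \<rho>(3) by (simp add: mult.assoc)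
        have "ln (real X * \<epsilon> - ln 2) - ln 2 \<le> (\<Sum>k<X * M. m k)"
          using sum_cell_mass_ge[OF \<rho>(1), of "X * M"] elim(2) unfolding eq m_def by blast
        with upper[OF elim(3)] elim(1) show False by linarith
      qed
      then show False by simp
    qed
    then obtain d where d: "d \<in> D" "\<not> summable (\<lambda>k. min (m k) (m (k + d)))" by blast
    have "real d * \<rho> \<le> real M * \<rho>" using d \<rho> by (intro mult_right_mono) (auto simp: D_def)
    then show "\<exists>d. \<delta> \<le> real d * (\<epsilon> / real M) \<and> real d * (\<epsilon> / real M) \<le> \<epsilon> \<and>
      \<not> summable (\<lambda>k. min (cell_mass (\<epsilon> / real M) k) (cell_mass (\<epsilon> / real M) (k + d)))"
      using d \<rho>(3) unfolding D_def m_def \<rho>_def by (intro exI[of _ d]) auto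
  qed
qed

section \<open>Oscillation of averages under dilation of the argument\<close>

definition scale_dev :: "(nat \<Rightarrow> real) \<Rightarrow> real \<Rightarrow> real \<Rightarrow> bool" where
  "scale_dev a c e \<longleftrightarrow> (\<forall>\<^sub>F x in at_top. \<bar>omega_avg a (c * x) - omega_avg a x\<bar> \<le> e)"

lemma filterlim_mult_at_top: "c > 0 \<Longrightarrow> filterlim (\<lambda>x. c * x) at_top (at_top :: real filter)"
  by (rule filterlim_tendsto_pos_mult_at_top[OF tendsto_const _ filterlim_ident])

lemma scale_dev_mult:
  assumes "scale_dev a c e" "scale_dev a c' e'" "c' > 0"
  shows "scale_dev a (c * c') (e + e')"
proof -
  have "\<forall>\<^sub>F x in at_top. \<bar>omega_avg a (c * (c' * x)) - omega_avg a (c' * x)\<bar> \<le> e"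
    using filterlim_mult_at_top[OF assms(3)] assms(1) unfolding scale_dev_def
    by (auto simp: filterlim_iff)
  with assms(2) show ?thesis
    unfolding scale_dev_def
  proof eventually_elim
    case (elim x)
    then show ?case by (simp add: mult.assoc)
  qed
qed

lemma scale_dev_power:
  assumes "scale_dev a c e" "c > 0"
  shows "scale_dev a (c ^ k) (real k * e)"
proof (induction k)
  case (Suc k)
  from scale_dev_mult[OF assms(1) Suc] assms(2) show ?case
    by (simp add: distrib_right)
qed (simp add: scale_dev_def)

lemma scale_dev_lipschitz:
  assumes a: "\<And>n. \<bar>a n\<bar> \<le> 1" and "r > 0" "\<bar>t\<bar> \<le> r"
  shows "scale_dev a (exp t) (3 * r)"
  unfolding scale_dev_def
proof -
  have "\<forall>\<^sub>F x in at_top. 1 / (exp t * x) + 1 / x \<le> r"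
    using \<open>r > 0\<close> by real_asymp
  with eventually_gt_at_top[of 0]
  show "\<forall>\<^sub>F x in at_top. \<bar>omega_avg a (exp t * x) - omega_avg a x\<bar> \<le> 3 * r"
  proof eventually_elim
    case (elim x)
    have "\<bar>omega_avg a (exp t * x) - omega_avg a x\<bar> \<le> 2 * r + 1 / (exp t * x) + 1 / x"
      using elim(1) assms(3) by (intro omega_avg_lipschitz[OF a]) (auto simp: ln_mult)
    with elim(2) show ?case by linarith
  qed
qed

text \<open>For most primes \<open>p\<close>, \<open>q\<close> in paired cells the averages at \<open>x / p\<close> and \<open>c * x / q\<close> of the
  shifted sequence are close to those of \<open>a\<close> at \<open>x\<close> and \<open>c * x\<close>; but \<open>x / p\<close> is nearly \<open>c * x / q\<close>.\<close>

lemma scale_dev_of_paired_cells: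
  assumes a: "\<And>n. \<bar>a n\<bar> \<le> 1" and \<rho>: "\<rho> > 0"
    and ns: "\<not> summable (\<lambda>k. min (cell_mass \<rho> k) (cell_mass \<rho> (k + d)))"
  shows "scale_dev a (exp (real d * \<rho>)) (5 * \<rho>)"
proof -
  define c where "c = exp (real d * \<rho>)"
  have "c > 0" by (simp add: c_def)
  define w where "w k = min (cell_mass \<rho> k) (cell_mass \<rho> (k + d))" for k
  have w0: "w k \<ge> 0" for k by (simp add: w_def cell_mass_nonneg)
  \<comment> \<open>The number 40 is the sum of the two bounds 20, for \<open>P\<close> at
    \<open>x\<close> and for \<open>Q\<close> at \<open>c * x\<close>.\<close>
  obtain n where n: "(\<Sum>k<n. w k) > 40 / \<rho>\<^sup>2"
  proof -
    have "\<exists>n. \<not> (\<Sum>k<n. w k) \<le> 40 / \<rho>\<^sup>2"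
      using ns w0 bounded_imp_summable[of w "40 / \<rho>\<^sup>2"] unfolding w_def[symmetric]
      by (metis lessThan_Suc_atMost)
    then show ?thesis using that by (auto simp: not_le)
  qed
  define P where "P = (\<Union>k\<in>{..<n}. prime_cell \<rho> k)"
  define Q where "Q = (\<Union>k\<in>{d..<n + d}. prime_cell \<rho> k)"
  have fin: "finite P" "finite Q" by (auto simp: P_def Q_def)
  have pr: "\<forall>p\<in>P. prime p" "\<forall>q\<in>Q. prime q"
    by (auto simp: P_def Q_def prime_cell_def)
  define e where "e x p = omega_avg (a \<circ> Suc) (x / real p) - omega_avg a x" for x and p :: nat
  have "\<forall>\<^sub>F x in at_top. \<forall>p\<in>P. real p / x \<le> \<rho> / 2"
    using \<rho> by (intro eventually_ball_finite fin ballI) real_asymp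
  moreover have "\<forall>\<^sub>F x in at_top. \<forall>q\<in>Q. real q / (c * x) \<le> \<rho> / 2"
    using \<rho> \<open>c > 0\<close> by (intro eventually_ball_finite fin ballI) real_asymp
  moreover have "\<forall>\<^sub>F x in at_top. (\<Sum>p\<in>P. (1 / real p) * (e x p)\<^sup>2) \<le> 20"
    unfolding e_def by (rule omega_avg_shift_square_sum[OF fin(1) pr(1) a])
  moreover have "\<forall>\<^sub>F x in at_top. (\<Sum>q\<in>Q. (1 / real q) * (e (c * x) q)\<^sup>2) \<le> 20"
    unfolding e_def
    by (rule eventually_compose_filterlim[OF omega_avg_shift_square_sum[OF fin(2) pr(2) a]
          filterlim_mult_at_top[OF \<open>c > 0\<close>]])
  ultimately show ?thesis
    unfolding scale_dev_def c_def[symmetric] using eventually_gt_at_top[of 0]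
  proof eventually_elim
    case (elim x)
    show ?case
    proof (rule ccontr)
      assume big: "\<not> \<bar>omega_avg a (c * x) - omega_avg a x\<bar> \<le> 5 * \<rho>"
      \<comment> \<open>If both deviations were at most \<open>\<rho>\<close>, the Lipschitz bound
        \<open>3 * \<rho>\<close> between the shifted averages would give a total of
        \<open>5 * \<rho>\<close>.\<close>
      have near: "\<rho> < \<bar>e x p\<bar> \<or> \<rho> < \<bar>e (c * x) q\<bar>"
        if "k < n" "p \<in> prime_cell \<rho> k" "q \<in> prime_cell \<rho> (k + d)" for k p q
      proof -
        have "p \<in> P"
          using that by (auto simp: P_def)
        have "k + d \<in> {d..<n + d}"
          using that by simp
        then have "q \<in> Q"
          using that unfolding Q_def by blast
        have pos: "real p > 0" "real q > 0"
          using that prime_gt_0_nat by (auto simp: prime_cell_def)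
        have "real p / x \<le> \<rho> / 2" "real q / (c * x) \<le> \<rho> / 2"
          using elim(1,2) \<open>p \<in> P\<close> \<open>q \<in> Q\<close> by auto
        moreover have "1 / (x / real p) = real p / x" "1 / (c * x / real q) = real q / (c * x)"
          by simp_all
        ultimately have small: "1 / (x / real p) + 1 / (c * x / real q) \<le> \<rho>" by linarith
        have "real k * \<rho> \<le> ln (real p)" "ln (real p) < real k * \<rho> + \<rho>"
          "real k * \<rho> + real d * \<rho> \<le> ln (real q)" "ln (real q) < real k * \<rho> + real d * \<rho> + \<rho>"
          using that(2,3) by (auto simp: prime_cell_def distrib_right)
        then have "ln (real q) - ln (real p) - real d * \<rho> \<le> \<rho>" "- \<rho> \<le> ln (real q) - ln (real p) - real d * \<rho>"
          by simp_all
        then have "\<bar>ln (x / real p) - ln (c * x / real q)\<bar> \<le> \<rho>"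
          using pos elim(5) \<open>c > 0\<close> by (simp add: ln_div ln_mult c_def abs_le_iff)
        then have "\<bar>omega_avg (a \<circ> Suc) (x / real p) - omega_avg (a \<circ> Suc) (c * x / real q)\<bar>
            \<le> 2 * \<rho> + 1 / (x / real p) + 1 / (c * x / real q)"
          using pos elim(5) \<open>c > 0\<close> a by (intro omega_avg_lipschitz) auto
        then show ?thesis
          using big small unfolding e_def by linarith
      qed
      have cell: "\<rho>\<^sup>2 * w k \<le> (\<Sum>p\<in>prime_cell \<rho> k. (1 / real p) * (e x p)\<^sup>2)
          + (\<Sum>q\<in>prime_cell \<rho> (k + d). (1 / real q) * (e (c * x) q)\<^sup>2)" if "k < n" for k
      proof -
        have *: "\<rho>\<^sup>2 * cell_mass \<rho> j \<le> (\<Sum>p\<in>prime_cell \<rho> j. (1 / real p) * (e y p)\<^sup>2)"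
          if "\<forall>p\<in>prime_cell \<rho> j. \<rho> < \<bar>e y p\<bar>" for j y
        proof -
          have "\<rho>\<^sup>2 * cell_mass \<rho> j = (\<Sum>p\<in>prime_cell \<rho> j. (1 / real p) * \<rho>\<^sup>2)"
            by (simp add: cell_mass_def sum_distrib_left mult.commute)
          also have "\<dots> \<le> (\<Sum>p\<in>prime_cell \<rho> j. (1 / real p) * (e y p)\<^sup>2)"
          proof (intro sum_mono mult_left_mono)
            fix p assume "p \<in> prime_cell \<rho> j"
            then have "\<bar>\<rho>\<bar> \<le> \<bar>e y p\<bar>" using that \<rho> by auto
            then show "\<rho>\<^sup>2 \<le> (e y p)\<^sup>2" by (simp add: abs_le_square_iff)
          qed auto
          finally show ?thesis .
        qed
        have nn: "(\<Sum>p\<in>prime_cell \<rho> j. (1 / real p) * (e y p)\<^sup>2) \<ge> 0" for j y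
          by (intro sum_nonneg) auto
        have wl: "\<rho>\<^sup>2 * w k \<le> \<rho>\<^sup>2 * cell_mass \<rho> k" "\<rho>\<^sup>2 * w k \<le> \<rho>\<^sup>2 * cell_mass \<rho> (k + d)"
          by (auto simp: w_def intro!: mult_left_mono)
        \<comment> \<open>Since every pair has a large deviation, a single good \<open>p\<close>
          forces all \<open>q\<close> to be bad. So one of the two cells is bad entirely, and its
          mass is at least \<open>w k\<close>.\<close>
        consider "\<forall>p\<in>prime_cell \<rho> k. \<rho> < \<bar>e x p\<bar>" | "\<forall>q\<in>prime_cell \<rho> (k + d). \<rho> < \<bar>e (c * x) q\<bar>"
          using near[OF \<open>k < n\<close>] by blast
        then show ?thesis
        proof cases
          case 1
          from *[OF 1] wl(1) nn[where j = "k + d" and y = "c * x"] show ?thesis by linarith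
        next
          case 2
          from *[OF 2] wl(2) nn[where j = k and y = x] show ?thesis by linarith
        qed
      qed
      have "\<rho>\<^sup>2 * (\<Sum>k<n. w k) \<le> (\<Sum>k<n. (\<Sum>p\<in>prime_cell \<rho> k. (1 / real p) * (e x p)\<^sup>2)
          + (\<Sum>q\<in>prime_cell \<rho> (k + d). (1 / real q) * (e (c * x) q)\<^sup>2))"
        unfolding sum_distrib_left by (intro sum_mono cell) auto
      also have "\<dots> = (\<Sum>k<n. \<Sum>p\<in>prime_cell \<rho> k. (1 / real p) * (e x p)\<^sup>2)
          + (\<Sum>k<n. \<Sum>q\<in>prime_cell \<rho> (k + d). (1 / real q) * (e (c * x) q)\<^sup>2)"
        by (rule sum.distrib)
      also have "(\<Sum>k<n. \<Sum>q\<in>prime_cell \<rho> (k + d). (1 / real q) * (e (c * x) q)\<^sup>2)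
          = (\<Sum>k\<in>{d..<n + d}. \<Sum>q\<in>prime_cell \<rho> k. (1 / real q) * (e (c * x) q)\<^sup>2)"
        using sum.shift_bounds_nat_ivl[of "\<lambda>k. \<Sum>q\<in>prime_cell \<rho> k. (1 / real q) * (e (c * x) q)\<^sup>2" 0 d n]
        by (simp add: lessThan_atLeast0)
      also have "(\<Sum>k<n. \<Sum>p\<in>prime_cell \<rho> k. (1 / real p) * (e x p)\<^sup>2) = (\<Sum>p\<in>P. (1 / real p) * (e x p)\<^sup>2)"
        unfolding P_def by (rule sum_cells[OF \<rho>]) simp
      also have "(\<Sum>k\<in>{d..<n + d}. \<Sum>q\<in>prime_cell \<rho> k. (1 / real q) * (e (c * x) q)\<^sup>2)
          = (\<Sum>q\<in>Q. (1 / real q) * (e (c * x) q)\<^sup>2)"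
        unfolding Q_def by (rule sum_cells[OF \<rho>]) simp
      finally have "\<rho>\<^sup>2 * (\<Sum>k<n. w k) \<le> 40"
        using elim(3,4) by linarith
      with n \<rho> show False by (simp add: field_simps)
    qed
  qed
qed

text \<open>The dilation by \<open>exp t\<close> is composed of \<open>k\<close> steps of size
  \<open>h\<close> and a remainder shorter than \<open>h \<le> \<epsilon>\<close>, left to the
  Lipschitz bound. Since \<open>h \<ge> \<delta>\<close> with \<open>\<delta>\<close> independent of
  \<open>\<rho>\<close>, the number of steps stays bounded while the cost \<open>5 * \<rho>\<close>
  of each is made small.\<close>

lemma scale_dev_all:
  assumes a: "\<And>n. \<bar>a n\<bar> \<le> 1" and "t \<ge> 0" "e > 0"
  shows "scale_dev a (exp t) e"
proof -
  define \<epsilon> where "\<epsilon> = e / 6"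
  have "\<epsilon> > 0" using assms by (simp add: \<epsilon>_def)
  from paired_cells[OF this] obtain \<delta> where \<delta>: "\<delta> > 0"
    "\<And>M. M > 0 \<Longrightarrow> \<epsilon> / real M \<le> \<delta> \<Longrightarrow> \<exists>d. \<delta> \<le> real d * (\<epsilon> / real M) \<and> real d * (\<epsilon> / real M) \<le> \<epsilon> \<and>
      \<not> summable (\<lambda>k. min (cell_mass (\<epsilon> / real M) k) (cell_mass (\<epsilon> / real M) (k + d)))"
    by blast
  \<comment> \<open>As \<open>k * \<delta> \<le> t\<close>, this makes the \<open>k\<close> steps
    cost at most \<open>e / 2\<close>; the remainder costs \<open>3 * \<epsilon>\<close>, which is
    the other half.\<close>
  define \<rho>0 where "\<rho>0 = min \<delta> (e * \<delta> / (10 * (t + 1)))"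
  have "\<rho>0 > 0" using \<delta> assms by (simp add: \<rho>0_def)
  obtain M :: nat where M: "real M > \<epsilon> / \<rho>0"
    using reals_Archimedean2 by blast
  have "\<epsilon> / \<rho>0 > 0" using \<open>\<epsilon> > 0\<close> \<open>\<rho>0 > 0\<close> by simp
  with M have "M > 0" by (metis of_nat_0_less_iff less_trans)
  define \<rho> where "\<rho> = \<epsilon> / real M"
  have \<rho>: "\<rho> > 0" "\<rho> \<le> \<rho>0"
    using M \<open>M > 0\<close> \<open>\<epsilon> > 0\<close> \<open>\<rho>0 > 0\<close> by (auto simp: \<rho>_def field_simps)
  then have "\<epsilon> / real M \<le> \<delta>" by (simp add: \<rho>_def \<rho>0_def)
  from \<delta>(2)[OF \<open>M > 0\<close> this] obtain d where d: "\<delta> \<le> real d * \<rho>" "real d * \<rho> \<le> \<epsilon>"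
    "\<not> summable (\<lambda>k. min (cell_mass \<rho> k) (cell_mass \<rho> (k + d)))"
    unfolding \<rho>_def[symmetric] by blast
  define h where "h = real d * \<rho>"
  have h: "h > 0" "\<delta> \<le> h" "h \<le> \<epsilon>" using d \<delta> by (auto simp: h_def)
  define k where "k = nat \<lfloor>t / h\<rfloor>"
  have th: "t / h \<ge> 0" using assms h by simp
  have "real k \<le> t / h" "t / h < real k + 1"
    using th unfolding k_def by linarith+
  then have k: "real k * h \<le> t" "t < real k * h + h"
    using h by (simp_all add: field_simps)
  have "scale_dev a (exp h ^ k) (real k * (5 * \<rho>))"
    using scale_dev_of_paired_cells[OF a \<rho>(1) d(3)] by (intro scale_dev_power) (auto simp: h_def)
  moreover have "scale_dev a (exp (t - real k * h)) (3 * \<epsilon>)"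
    using k h \<open>\<epsilon> > 0\<close> by (intro scale_dev_lipschitz[OF a]) auto
  ultimately have "scale_dev a (exp h ^ k * exp (t - real k * h)) (real k * (5 * \<rho>) + 3 * \<epsilon>)"
    by (rule scale_dev_mult) simp
  moreover have "exp h ^ k * exp (t - real k * h) = exp t"
    by (simp add: exp_diff flip: exp_of_nat_mult)
  moreover have "real k * (5 * \<rho>) + 3 * \<epsilon> \<le> e"
  proof -
    have "real k * \<delta> \<le> real k * h" using h by (intro mult_left_mono) auto
    then have kd: "real k * \<delta> \<le> t" using k by linarith
    have "real k * \<rho> \<le> real k * (e * \<delta> / (10 * (t + 1)))"
      using \<rho>(2) unfolding \<rho>0_def by (intro mult_left_mono) auto
    also have "\<dots> = (real k * \<delta>) * (e / (10 * (t + 1)))" by simp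
    also have "\<dots> \<le> (t + 1) * (e / (10 * (t + 1)))"
      using kd assms by (intro mult_right_mono) auto
    also have "\<dots> = e / 10" using assms by (simp add: field_simps)
    finally show ?thesis by (simp add: \<epsilon>_def)
  qed
  ultimately show ?thesis
    unfolding scale_dev_def by (auto elim!: eventually_mono)
qed

text \<open>Slow variation replaces the shifted average at \<open>x\<close> by those at
  \<open>x / p\<close>, for finitely many \<open>p\<close>, with error \<open>\<eta>\<close>. A
  large difference at \<open>x\<close> would thus be a deviation of at least \<open>\<eta>\<close>
  for every \<open>p\<close> in \<open>P\<close>, too much for the bound 20 once the sum of
  \<open>1 / p\<close> exceeds \<open>20 / \<eta>^2\<close>.\<close>

lemma omega_avg_shift_tendsto:
  assumes a: "\<And>n. \<bar>a n\<bar> \<le> 1"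
  shows "((\<lambda>x. omega_avg (a \<circ> Suc) x - omega_avg a x) \<longlongrightarrow> 0) at_top"
proof (rule tendstoI)
  fix e :: real assume "e > 0"
  define \<eta> where "\<eta> = e / 3"
  have "\<eta> > 0" using \<open>e > 0\<close> by (simp add: \<eta>_def)
  have "filterlim (\<lambda>N::nat. ln (ln (real N + 1)) - ln 2) at_top sequentially"
    by real_asymp
  then have "\<forall>\<^sub>F N::nat in sequentially. ln (ln (real N + 1)) - ln 2 > 20 / \<eta>\<^sup>2"
    unfolding filterlim_at_top_dense by blast
  with eventually_ge_at_top[of 1] have "\<forall>\<^sub>F N in sequentially. (\<Sum>p | prime p \<and> p \<le> N. 1 / real p) > 20 / \<eta>\<^sup>2"
  proof eventually_elim
    case (elim N)
    with sum_inverse_primes_ge[of N] show ?case by linarith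
  qed
  then obtain N where N: "(\<Sum>p | prime p \<and> p \<le> N. 1 / real p) > 20 / \<eta>\<^sup>2"
    by (auto simp: eventually_sequentially)
  define P where "P = {p. prime p \<and> p \<le> N}"
  have P: "finite P" "\<forall>p\<in>P. prime p" by (auto simp: P_def)
  have "\<forall>\<^sub>F x in at_top. \<bar>omega_avg (a \<circ> Suc) (x / real p) - omega_avg (a \<circ> Suc) x\<bar> \<le> \<eta>" if "p \<in> P" for p
  proof -
    have "real p \<ge> 1" using P(2) that prime_gt_0_nat by (force simp: Suc_le_eq)
    then have "scale_dev (a \<circ> Suc) (exp (ln (real p))) \<eta>"
      using a \<open>\<eta> > 0\<close> by (intro scale_dev_all) auto
    then have "scale_dev (a \<circ> Suc) (real p) \<eta>"
      using \<open>real p \<ge> 1\<close> by simp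
    \<comment> \<open>Substituting \<open>x / p\<close> for \<open>x\<close> turns dilation by
      \<open>p\<close> into division by \<open>p\<close>.\<close>
    from eventually_compose_filterlim[OF this[unfolded scale_dev_def] filterlim_mult_at_top[of "1 / real p"]]
    show ?thesis using \<open>real p \<ge> 1\<close> by (simp add: abs_minus_commute)
  qed
  then have "\<forall>\<^sub>F x in at_top. \<forall>p\<in>P. \<bar>omega_avg (a \<circ> Suc) (x / real p) - omega_avg (a \<circ> Suc) x\<bar> \<le> \<eta>"
    using P by (intro eventually_ball_finite) auto
  with omega_avg_shift_square_sum[of P a, OF P a]
  show "\<forall>\<^sub>F x in at_top. dist (omega_avg (a \<circ> Suc) x - omega_avg a x) 0 < e"
  proof eventually_elim
    case (elim x)
    show ?case
    proof (rule ccontr)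
      assume "\<not> ?thesis"
      then have big: "\<bar>omega_avg (a \<circ> Suc) x - omega_avg a x\<bar> \<ge> 3 * \<eta>" by (simp add: \<eta>_def)
      have "\<eta>\<^sup>2 * (\<Sum>p\<in>P. 1 / real p) = (\<Sum>p\<in>P. (1 / real p) * \<eta>\<^sup>2)"
        by (simp add: sum_distrib_left mult.commute)
      also have "\<dots> \<le> (\<Sum>p\<in>P. (1 / real p) * (omega_avg (a \<circ> Suc) (x / real p) - omega_avg a x)\<^sup>2)"
      proof (intro sum_mono mult_left_mono)
        fix p assume "p \<in> P"
        then have "\<bar>\<eta>\<bar> \<le> \<bar>omega_avg (a \<circ> Suc) (x / real p) - omega_avg a x\<bar>"
          using elim(2) big \<open>\<eta> > 0\<close> by fastforce
        then show "\<eta>\<^sup>2 \<le> (omega_avg (a \<circ> Suc) (x / real p) - omega_avg a x)\<^sup>2"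
          by (simp add: abs_le_square_iff)
      qed auto
      also have "\<dots> \<le> 20" by (rule elim(1))
      finally show False
        using N \<open>\<eta> > 0\<close> by (simp add: P_def field_simps)
    qed
  qed
qed

corollary omega_shift_averages:
  fixes b :: "nat \<Rightarrow> real"
  assumes b: "\<And>n. \<bar>b n\<bar> \<le> B"
  shows "(\<lambda>N. (\<Sum>n = 1..N. b (Suc (omega n))) / real N - (\<Sum>n = 1..N. b (omega n)) / real N) \<longlonglongrightarrow> 0"
proof -
  \<comment> \<open>Adding 1 keeps the divisor positive when \<open>B = 0\<close>.\<close>
  define C where "C = B + 1"
  have "C > 0" using b[of 0] by (simp add: C_def)
  define a where "a n = b n / C" for n
  have "\<bar>a n\<bar> \<le> 1" for n
    using b[of n] \<open>C > 0\<close> by (simp add: a_def C_def)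
  then have "((\<lambda>x. omega_avg (a \<circ> Suc) x - omega_avg a x) \<longlongrightarrow> 0) at_top"
    by (rule omega_avg_shift_tendsto)
  from filterlim_compose[OF this filterlim_real_sequentially]
  have "(\<lambda>N. C * (omega_avg (a \<circ> Suc) (real N) - omega_avg a (real N))) \<longlonglongrightarrow> C * 0"
    by (rule tendsto_mult_left)
  then show ?thesis
    using \<open>C > 0\<close>
    by (simp add: omega_avg_def a_def right_diff_distrib flip: sum_divide_distrib)
qed

section \<open>Weak limits of empirical measures\<close>

text \<open>The first nonzero digit contributes \<open>(1/4)^i\<close>, and all later ones together
  at most a third of that. In base 2 they could cancel it.\<close>

lemma base4_digits_differ:
  fixes \<delta> :: "nat \<Rightarrow> real"
  assumes "\<And>j. \<bar>\<delta> j\<bar> \<le> 1" "\<bar>\<delta> i\<bar> = 1" "\<And>j. j < i \<Longrightarrow> \<delta> j = 0"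
  shows "\<bar>\<Sum>j. \<delta> j * (1/4)^j\<bar> \<ge> (2/3) * (1/4)^i"
proof -
  have bound: "norm (\<delta> j * (1/4)^j) \<le> (1/4)^j" for j
    using assms(1)[of j] by (simp add: abs_mult mult_left_le_one_le)
  have geo: "summable (\<lambda>j. (1/4::real)^j)"
    by (simp add: summable_geometric)
  have sm: "summable (\<lambda>j. \<delta> j * (1/4)^j)"
    by (rule summable_comparison_test'[OF geo, of 0]) (use bound in auto)
  have sm2: "summable (\<lambda>j. \<bar>\<delta> (j + Suc i) * (1/4)^(j + Suc i)\<bar>)"
    using bound
    by (intro summable_comparison_test'[OF summable_ignore_initial_segment[OF geo, of "Suc i"], of 0])
      (simp only: real_norm_def abs_idempotent)
  have "\<bar>\<Sum>j. \<delta> (j + Suc i) * (1/4)^(j + Suc i)\<bar> \<le> (\<Sum>j. \<bar>\<delta> (j + Suc i) * (1/4)^(j + Suc i)\<bar>)"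
    by (rule summable_rabs[OF sm2])
  also have "\<dots> \<le> (\<Sum>j. (1/4)^Suc i * (1/4)^j)"
  proof (intro suminf_le sm2 summable_mult geo)
    fix j
    have "(1/4::real)^(j + Suc i) = (1/4)^Suc i * (1/4)^j"
      by (simp only: power_add mult.commute)
    with bound[of "j + Suc i"] show "\<bar>\<delta> (j + Suc i) * (1/4)^(j + Suc i)\<bar> \<le> (1/4)^Suc i * (1/4)^j"
      by (simp only: real_norm_def)
  qed
  also have "\<dots> = (1/4)^Suc i * (\<Sum>j. (1/4)^j)"
    by (rule suminf_mult[OF geo])
  also have "\<dots> = (1/3) * (1/4)^i"
    by (subst suminf_geometric) auto
  finally have tail: "\<bar>\<Sum>j. \<delta> (j + Suc i) * (1/4)^(j + Suc i)\<bar> \<le> (1/3) * (1/4)^i" .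
  have "(\<Sum>j. \<delta> j * (1/4)^j) = (\<Sum>j. \<delta> (j + Suc i) * (1/4)^(j + Suc i)) + (\<Sum>j<Suc i. \<delta> j * (1/4)^j)"
    by (rule suminf_split_initial_segment[OF sm])
  also have "(\<Sum>j<Suc i. \<delta> j * (1/4)^j) = \<delta> i * (1/4)^i"
    using assms(3) by (simp add: sum.lessThan_Suc)
  finally have eq: "(\<Sum>j. \<delta> j * (1/4)^j) = (\<Sum>j. \<delta> (j + Suc i) * (1/4)^(j + Suc i)) + \<delta> i * (1/4)^i" .
  have "\<bar>\<delta> i * (1/4)^i\<bar> = (1/4)^i"
    using assms(2) by (simp add: abs_mult)
  with eq tail show ?thesis by linarith
qed

text \<open>The code of a point records in base 4 which sets of a sequence of balls it belongs to; the
  code is not continuous, but close codes come from close points.\<close>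

lemma compact_real_coding:
  fixes X :: "'a::metric_space set"
  assumes "compact X" "X \<noteq> {}"
  obtains \<psi> :: "'a \<Rightarrow> real" where
    "\<And>x. 0 \<le> \<psi> x" "\<And>x. \<psi> x \<le> 4/3"
    "\<And>e. e > 0 \<Longrightarrow> \<exists>d>0. \<forall>x\<in>X. \<forall>y\<in>X. \<bar>\<psi> x - \<psi> y\<bar> < d \<longrightarrow> dist x y < e"
proof -
  have "\<exists>k. finite k \<and> X \<subseteq> (\<Union>x\<in>k. ball x (1 / real (Suc n)))" for n
    using assms(1) unfolding compact_eq_totally_bounded by auto
  then obtain C where C: "\<And>n. finite (C n)"
      "\<And>n. X \<subseteq> (\<Union>x\<in>C n. ball x (1 / real (Suc n)))"
    by metis
  define D where "D = (SIGMA n:UNIV. C n)"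
  have cD: "countable D"
    unfolding D_def by (intro countable_SIGMA) (auto simp: C(1) countable_finite)
  define U where "U j = (case from_nat_into D j of (n, c) \<Rightarrow> ball c (1 / real (Suc n)))" for j
  define \<psi> where "\<psi> x = (\<Sum>j. of_bool (x \<in> U j) * (1/4::real)^j)" for x
  have geo: "summable (\<lambda>j. (1/4::real)^j)"
    by (simp add: summable_geometric)
  have sm: "summable (\<lambda>j. of_bool (x \<in> U j) * (1/4::real)^j)" for x
    by (rule summable_comparison_test'[OF geo, of 0]) auto
  show ?thesis
  proof
    show "0 \<le> \<psi> x" for x
      unfolding \<psi>_def by (intro suminf_nonneg sm) auto
    have "\<psi> x \<le> (\<Sum>j. (1/4::real)^j)" for x
      unfolding \<psi>_def by (intro suminf_le sm geo) auto
    then show "\<psi> x \<le> 4/3" for x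
      using suminf_geometric[of "1/4::real"] by auto
    fix e :: real assume "e > 0"
    then obtain n where n: "1 / real (Suc n) < e/2"
      using nat_approx_posE[of "e/2"] by auto
    \<comment> \<open>Bounds the positions of all balls of radius \<open>1 / (n + 1)\<close>. Codes
      closer than \<open>(2/3) * (1/4)^m\<close> agree in all digits up to \<open>m\<close>, so some
      such ball contains both points.\<close>
    define m where "m = Max (insert 0 (to_nat_on D ` ({n} \<times> C n)))"
    show "\<exists>d>0. \<forall>x\<in>X. \<forall>y\<in>X. \<bar>\<psi> x - \<psi> y\<bar> < d \<longrightarrow> dist x y < e"
    proof (intro exI conjI ballI impI)
      show "(2/3) * (1/4::real)^m > 0" by simp
      fix x y assume xy: "x \<in> X" "y \<in> X" "\<bar>\<psi> x - \<psi> y\<bar> < (2/3) * (1/4)^m"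
      define \<delta> where "\<delta> j = of_bool (x \<in> U j) - (of_bool (y \<in> U j) :: real)" for j
      have "\<psi> x - \<psi> y = (\<Sum>j. of_bool (x \<in> U j) * (1/4)^j - of_bool (y \<in> U j) * (1/4)^j)"
        unfolding \<psi>_def by (rule suminf_diff[OF sm sm])
      then have diff: "\<psi> x - \<psi> y = (\<Sum>j. \<delta> j * (1/4)^j)"
        by (simp add: \<delta>_def left_diff_distrib)
      have same: "\<delta> j = 0" if "j \<le> m" for j
      proof (rule ccontr)
        assume "\<delta> j \<noteq> 0"
        define i where "i = (LEAST i. \<delta> i \<noteq> 0)"
        have i: "\<delta> i \<noteq> 0" "i \<le> j"
          unfolding i_def using \<open>\<delta> j \<noteq> 0\<close> by (rule LeastI, rule Least_le)
        have less: "\<delta> k = 0" if "k < i" for k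
          using not_less_Least that unfolding i_def by blast
        have "\<bar>\<delta> i\<bar> = 1"
          using i(1) by (auto simp: \<delta>_def split: if_splits)
        then have "\<bar>\<Sum>j. \<delta> j * (1/4)^j\<bar> \<ge> (2/3) * (1/4)^i"
          by (intro base4_digits_differ less) (auto simp: \<delta>_def)
        moreover have "(1/4::real)^i \<ge> (1/4)^m"
          using i(2) that by (intro power_decreasing) auto
        ultimately show False
          using xy(3) diff by linarith
      qed
      obtain c where c: "c \<in> C n" "dist c x < 1 / real (Suc n)"
        using C(2)[of n] xy(1) by auto
      define j where "j = to_nat_on D (n, c)"
      have "(n, c) \<in> D"
        using c by (simp add: D_def)
      then have Uj: "U j = ball c (1 / real (Suc n))"
        using cD by (simp add: U_def j_def)
      have "j \<le> m"
        unfolding m_def j_def by (intro Max_ge) (use C(1) c in auto)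
      from same[OF this] have "x \<in> U j \<longleftrightarrow> y \<in> U j"
        by (auto simp: \<delta>_def of_bool_def split: if_splits)
      then have "dist c y < 1 / real (Suc n)"
        using c Uj by auto
      then show "dist x y < e"
        using c(2) n dist_triangle3[of x y c] by linarith
    qed
  qed
qed

text \<open>The inverse of the code is uniformly continuous, and \<open>X\<close> is complete, so it
  extends to the closure of the codes. The closure is taken because weak limits of measures on the
  codes are carried by it.\<close>

lemma coding_inverse:
  fixes X :: "'a::metric_space set" and \<psi> :: "'a \<Rightarrow> real"
  assumes "compact X"
    and \<psi>: "\<And>e. e > 0 \<Longrightarrow> \<exists>d>0. \<forall>x\<in>X. \<forall>y\<in>X. \<bar>\<psi> x - \<psi> y\<bar> < d \<longrightarrow> dist x y < e"
  obtains \<phi> where "continuous_on (closure (\<psi> ` X)) \<phi>" "\<phi> ` closure (\<psi> ` X) \<subseteq> X"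
    "\<And>x. x \<in> X \<Longrightarrow> \<phi> (\<psi> x) = x"
proof -
  \<comment> \<open>\<open>x\<close> is a limit of points of \<open>X\<close> whose codes tend to
    \<open>z\<close>. Compactness supplies such an \<open>x\<close>; the modulus below gives its
    uniqueness and the continuity in \<open>z\<close>.\<close>
  define R where "R z x \<longleftrightarrow> x \<in> X \<and> (\<forall>\<delta>>0. \<exists>u\<in>X. \<bar>\<psi> u - z\<bar> < \<delta> \<and> dist u x < \<delta>)" for z x
  have ex: "\<exists>x. R z x" if z: "z \<in> closure (\<psi> ` X)" for z
  proof -
    obtain v where v: "\<And>n. v n \<in> \<psi> ` X" "v \<longlonglongrightarrow> z"
      using z unfolding closure_sequential by auto
    have "\<forall>n. \<exists>x. x \<in> X \<and> v n = \<psi> x"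
      using v(1) by blast
    from choice[OF this] obtain u where u: "\<And>n. u n \<in> X" "\<And>n. v n = \<psi> (u n)"
      by blast
    obtain x r where x: "x \<in> X" "strict_mono r" "(u \<circ> r) \<longlonglongrightarrow> x"
      using assms(1) u(1) unfolding compact_def by blast
    have vr: "(v \<circ> r) \<longlonglongrightarrow> z"
      using v(2) x(2) by (rule LIMSEQ_subseq_LIMSEQ)
    have "\<exists>u\<in>X. \<bar>\<psi> u - z\<bar> < \<delta> \<and> dist u x < \<delta>" if "\<delta> > 0" for \<delta>
    proof -
      have "\<forall>\<^sub>F n in sequentially. dist ((v \<circ> r) n) z < \<delta> \<and> dist ((u \<circ> r) n) x < \<delta>"
        by (intro eventually_conj tendstoD[OF vr] tendstoD[OF x(3)] that)
      then obtain n where "dist ((v \<circ> r) n) z < \<delta>" "dist ((u \<circ> r) n) x < \<delta>"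
        by (auto simp: eventually_sequentially)
      then show ?thesis
        using u by (intro bexI[of _ "u (r n)"]) (auto simp: dist_real_def)
    qed
    with x(1) show ?thesis
      unfolding R_def by blast
  qed
  have modulus: "\<exists>d>0. \<forall>z w x y. R z x \<and> R w y \<and> \<bar>z - w\<bar> < d \<longrightarrow> dist x y < e" if "e > 0" for e
  proof -
    have "e/3 > 0"
      using that by simp
    from \<psi>[OF this] obtain d where d: "d > 0"
      "\<And>x y. x \<in> X \<Longrightarrow> y \<in> X \<Longrightarrow> \<bar>\<psi> x - \<psi> y\<bar> < d \<Longrightarrow> dist x y < e/3"
      by blast
    have "dist x y < e" if H: "R z x" "R w y" "\<bar>z - w\<bar> < d/3" for z w x y
    proof -
      define \<delta> where "\<delta> = min (d/3) (e/3)"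
      have "\<delta> > 0" using d(1) \<open>e > 0\<close> by (simp add: \<delta>_def)
      then obtain u v where u: "u \<in> X" "\<bar>\<psi> u - z\<bar> < \<delta>" "dist u x < \<delta>"
        and v: "v \<in> X" "\<bar>\<psi> v - w\<bar> < \<delta>" "dist v y < \<delta>"
        using H(1,2) unfolding R_def by meson
      have "\<bar>\<psi> u - \<psi> v\<bar> < d"
        using u(2) v(2) H(3) min.cobounded1[of "d/3" "e/3"] unfolding \<delta>_def by linarith
      then have "dist u v < e/3"
        using d(2) u(1) v(1) by blast
      moreover have "dist x y \<le> dist u x + dist u v + dist v y"
        using dist_triangle3[of x y u] dist_triangle[of u y v] by linarith
      ultimately show ?thesis
        using u(3) v(3) min.cobounded2[of "d/3" "e/3"] unfolding \<delta>_def by linarith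
    qed
    then show ?thesis
      using d(1) by (intro exI[of _ "d/3"]) auto
  qed
  obtain \<phi> where \<phi>: "\<And>z. z \<in> closure (\<psi> ` X) \<Longrightarrow> R z (\<phi> z)"
    using ex by metis
  show ?thesis
  proof
    show "\<phi> ` closure (\<psi> ` X) \<subseteq> X"
      using \<phi> unfolding R_def by blast
    show "continuous_on (closure (\<psi> ` X)) \<phi>"
      unfolding continuous_on_iff
    proof (intro ballI allI impI)
      fix z e :: real assume z: "z \<in> closure (\<psi> ` X)" and "e > 0"
      obtain d where "d > 0" "\<And>z w x y. R z x \<Longrightarrow> R w y \<Longrightarrow> \<bar>z - w\<bar> < d \<Longrightarrow> dist x y < e"
        using modulus[OF \<open>e > 0\<close>] by blast
      then show "\<exists>d>0. \<forall>x'\<in>closure (\<psi> ` X). dist x' z < d \<longrightarrow> dist (\<phi> x') (\<phi> z) < e"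
        unfolding dist_real_def using \<phi> z by blast
    qed
    fix x assume x: "x \<in> X"
    then have "R (\<psi> x) x"
      unfolding R_def by (auto intro: bexI[of _ x])
    moreover have "R (\<psi> x) (\<phi> (\<psi> x))"
      by (rule \<phi>) (rule subsetD[OF closure_subset imageI[OF x]])
    ultimately have "dist (\<phi> (\<psi> x)) x < e" if "e > 0" for e
      using modulus[OF that] by force
    then show "\<phi> (\<psi> x) = x"
      by (meson zero_less_dist_iff less_irrefl)
  qed
qed

text \<open>The empirical measures are transported to the real line by the code, a weak limit is
  extracted there by tightness, and it is carried back by the continuous inverse
  \<open>\<phi>\<close>. Convergence is tested on extensions of \<open>f \<circ> \<phi>\<close>,
  whose values at the codes are those of \<open>f\<close> at the points.\<close>

lemma empirical_measure_limit:
  fixes X :: "'a::metric_space set" and y :: "nat \<Rightarrow> 'a"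
  assumes "compact X" "\<And>n. y n \<in> X" "strict_mono s"
  obtains r \<nu> where "strict_mono (r :: nat \<Rightarrow> nat)" "prob_space \<nu>"
    "sets \<nu> = sets (restrict_space borel X)"
    "\<forall>f :: 'a \<Rightarrow> real. continuous_on X f \<longrightarrow>
       (\<lambda>k. (\<Sum>n = 1..Suc (s (r k)). f (y n)) / Suc (s (r k))) \<longlonglongrightarrow> (LINT x|\<nu>. f x)"
proof -
  have "X \<noteq> {}" using assms(2) by auto
  obtain \<psi> :: "'a \<Rightarrow> real" where \<psi>: "\<And>x. 0 \<le> \<psi> x" "\<And>x. \<psi> x \<le> 4/3"
    "\<And>e. e > 0 \<Longrightarrow> \<exists>d>0. \<forall>x\<in>X. \<forall>y\<in>X. \<bar>\<psi> x - \<psi> y\<bar> < d \<longrightarrow> dist x y < e"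
    using compact_real_coding[OF assms(1) \<open>X \<noteq> {}\<close>] by blast
  define K where "K = closure (\<psi> ` X)"
  obtain \<phi> where \<phi>: "continuous_on K \<phi>" "\<phi> ` K \<subseteq> X" "\<And>x. x \<in> X \<Longrightarrow> \<phi> (\<psi> x) = x"
    using coding_inverse[OF assms(1) \<psi>(3)] unfolding K_def by blast
  have K: "closed K" "K \<noteq> {}" "\<And>n. \<psi> (y n) \<in> K"
    using \<open>X \<noteq> {}\<close> assms(2) closure_subset[of "\<psi> ` X"] by (auto simp: K_def)
  \<comment> \<open>The range ends at \<open>Suc N\<close> so that it is never empty.\<close>
  define \<mu> where "\<mu> N = distr (measure_pmf (pmf_of_set {1..Suc N})) borel (\<lambda>n. \<psi> (y n))" for N
  have rd: "real_distribution (\<mu> N)" for N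
    unfolding \<mu>_def real_distribution_def real_distribution_axioms_def
    by (auto intro!: prob_space.prob_space_distr prob_space_measure_pmf)
  have int: "(LINT z|\<mu> N. g z) = (\<Sum>n = 1..Suc N. g (\<psi> (y n))) / Suc N"
    if [measurable]: "g \<in> borel_measurable borel" for g :: "real \<Rightarrow> real" and N
    unfolding \<mu>_def by (subst integral_distr) (auto simp: integral_pmf_of_set)
  have "measure (\<mu> N) {-1<..2} = 1" for N
  proof -
    have "-1 < \<psi> (y n)" "\<psi> (y n) \<le> 2" for n
      using \<psi>(1)[of "y n"] \<psi>(2)[of "y n"] by linarith+
    then have "(\<lambda>n. \<psi> (y n)) -` {-1<..2} = UNIV"
      by auto
    then show ?thesis
      unfolding \<mu>_def by (subst measure_distr) auto
  qed
  then have "tight \<mu>"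
    unfolding tight_def using rd by (intro conjI allI impI exI[of _ "-1"] exI[of _ 2]) auto
  from tight_imp_convergent_subsubsequence[OF this assms(3)]
  obtain r M where r: "strict_mono r" "real_distribution M" "weak_conv_m (\<mu> \<circ> s \<circ> r) M"
    by auto
  interpret M: real_distribution M by fact
  have lim: "(\<lambda>k. (\<Sum>n = 1..Suc (s (r k)). g (\<psi> (y n))) / Suc (s (r k))) \<longlonglongrightarrow> (LINT z|M. g z)"
    if g: "continuous_on UNIV g" "\<And>z. norm (g z) \<le> B" for g :: "real \<Rightarrow> real" and B
  proof -
    have "(\<lambda>k. LINT z|(\<mu> \<circ> s \<circ> r) k. g z) \<longlonglongrightarrow> (LINT z|M. g z)"
      by (rule weak_conv_imp_integral_bdd_continuous_conv[OF _ r(2,3) _ g(2)])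
        (use rd g(1) in \<open>auto simp: continuous_on_eq_continuous_at\<close>)
    then show ?thesis
      using borel_measurable_continuous_onI[OF g(1)] by (simp add: int)
  qed
  \<comment> \<open>The truncated distance to \<open>K\<close> is a bounded continuous test function
    vanishing at all codes, so its integral against the limit is 0.\<close>
  have AE_K: "AE z in M. z \<in> K"
  proof -
    define g where "g z = min 1 (infdist z K)" for z
    have g: "continuous_on UNIV g" "\<And>z. 0 \<le> g z" "\<And>z. norm (g z) \<le> 1"
      unfolding g_def using infdist_nonneg[of _ K] by (auto intro!: continuous_intros)
    then have gm [measurable]: "g \<in> borel_measurable borel"
      by (intro borel_measurable_continuous_onI)
    have "g (\<psi> (y n)) = 0" for n
      using K by (simp add: g_def)
    then have "(LINT z|M. g z) = 0"
      using LIMSEQ_unique[OF lim[OF g(1,3)]] by simp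
    moreover have "integrable M g"
      by (rule M.integrable_const_bound[of _ 1]) (use g in auto)
    ultimately have "AE z in M. g z = 0"
      using g(2) by (subst (asm) integral_nonneg_eq_0_iff_AE) auto
    then show ?thesis
    proof eventually_elim
      case (elim z)
      then have "infdist z K = 0"
        by (auto simp: g_def min_def split: if_splits)
      then show ?case
        using K(1,2) in_closed_iff_infdist_zero by blast
    qed
  qed
  obtain x0 where "x0 \<in> X" using \<open>X \<noteq> {}\<close> by auto
  \<comment> \<open>The value \<open>x0\<close> is taken only on a null set of \<open>M\<close>; it
    makes the map total with values in \<open>X\<close>.\<close>
  define \<phi>' where "\<phi>' z = (if z \<in> K then \<phi> z else x0)" for z
  have [measurable]: "K \<in> sets borel"
    using K(1) by (rule borel_closed)
  have \<phi>'_borel: "\<phi>' \<in> borel_measurable borel"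
    unfolding \<phi>'_def using borel_measurable_continuous_on_if[OF _ \<phi>(1) continuous_on_const] by simp
  have \<phi>': "\<phi>' \<in> measurable M (restrict_space borel X)"
    using \<phi>(2) \<open>x0 \<in> X\<close> \<phi>'_borel by (intro measurable_restrict_space2) (auto simp: \<phi>'_def image_subset_iff)
  define \<nu> where "\<nu> = distr M (restrict_space borel X) \<phi>'"
  show ?thesis
  proof
    show "strict_mono r" by fact
    show "prob_space \<nu>"
      unfolding \<nu>_def by (rule M.prob_space_distr[OF \<phi>'])
    show "sets \<nu> = sets (restrict_space borel X)"
      by (simp add: \<nu>_def)
    show "\<forall>f :: 'a \<Rightarrow> real. continuous_on X f \<longrightarrow>
       (\<lambda>k. (\<Sum>n = 1..Suc (s (r k)). f (y n)) / Suc (s (r k))) \<longlonglongrightarrow> (LINT x|\<nu>. f x)"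
    proof (intro allI impI)
      fix f :: "'a \<Rightarrow> real" assume f: "continuous_on X f"
      have "bounded (f ` X)"
        using f assms(1) by (intro compact_imp_bounded compact_continuous_image)
      then obtain B where B: "\<And>x. x \<in> X \<Longrightarrow> norm (f x) \<le> B" "0 < B"
        unfolding bounded_pos by auto
      have "continuous_on K (f \<circ> \<phi>)"
        using \<phi>(1) continuous_on_subset[OF f \<phi>(2)] by (rule continuous_on_compose)
      \<comment> \<open>Tietze's theorem extends \<open>f \<circ> \<phi>\<close> to a bounded
        continuous function on the whole line, as weak convergence requires.\<close>
      then obtain g where g: "continuous_on UNIV g" "\<And>z. z \<in> K \<Longrightarrow> g z = (f \<circ> \<phi>) z"
          "\<And>z. norm (g z) \<le> B"
        by (rule Tietze[of K _ UNIV B]) (use K \<phi>(2) B in auto)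
      have "(LINT x|\<nu>. f x) = (LINT z|M. f (\<phi>' z))"
        unfolding \<nu>_def by (rule integral_distr[OF \<phi>' borel_measurable_continuous_on_restrict[OF f]])
      also have "\<dots> = (LINT z|M. g z)"
      proof (rule integral_cong_AE)
        show "(\<lambda>z. f (\<phi>' z)) \<in> borel_measurable M"
          by (rule measurable_compose[OF \<phi>' borel_measurable_continuous_on_restrict[OF f]])
        show "g \<in> borel_measurable M"
          using borel_measurable_continuous_onI[OF g(1)] by simp
        show "AE z in M. f (\<phi>' z) = g z"
          using AE_K by eventually_elim (simp add: \<phi>'_def g(2))
    qed
    finally have "(LINT x|\<nu>. f x) = (LINT z|M. g z)" .
    moreover have "g (\<psi> (y n)) = f (y n)" for n
      using g(2) K(3) \<phi>(3) assms(2) by simp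
    ultimately show "(\<lambda>k. (\<Sum>n = 1..Suc (s (r k)). f (y n)) / Suc (s (r k))) \<longlonglongrightarrow> (LINT x|\<nu>. f x)"
      using lim[OF g(1,3)] by simp
    qed
  qed
qed

text \<open>Closed sets form an intersection-stable generator, and the indicator of a closed set is
  a bounded pointwise limit of continuous functions of the distance to it.\<close>

lemma prob_measure_eq_by_continuous:
  fixes X :: "'a::metric_space set"
  assumes "closed X" "prob_space M" "prob_space N"
    and sM: "sets M = sets (restrict_space borel X)" and sN: "sets N = sets (restrict_space borel X)"
    and eq: "\<And>f :: 'a \<Rightarrow> real. continuous_on X f \<Longrightarrow> (\<And>x. \<bar>f x\<bar> \<le> 1) \<Longrightarrow> (LINT x|M. f x) = (LINT x|N. f x)"
  shows "M = N"
proof (rule measure_eqI_generator_eq[where E = "{A. A \<subseteq> X \<and> closed A}" and \<Omega> = X and A = "\<lambda>_. X"])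
  interpret M: prob_space M by fact
  interpret N: prob_space N by fact
  have sp: "space M = X" "space N = X"
    using sets_eq_imp_space_eq[OF sM] sets_eq_imp_space_eq[OF sN] by (auto simp: space_restrict_space)
  have "sets (restrict_space borel X) = sigma_sets X ((\<inter>) X ` {A. closed A})"
    unfolding borel_eq_closed sets_restrict_space using assms(1)
    by (subst sigma_sets_Int[symmetric]) (auto intro: sigma_sets.Basic)
  also have "(\<inter>) X ` {A. closed A} = {A. A \<subseteq> X \<and> closed A}"
    using assms(1) by (auto intro: image_eqI[of _ _ A for A])
  finally show "sets M = sigma_sets X {A. A \<subseteq> X \<and> closed A}" "sets N = sigma_sets X {A. A \<subseteq> X \<and> closed A}"
    by (simp_all add: sM sN)
  show "Int_stable {A. A \<subseteq> X \<and> closed A}"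
    by (auto simp: Int_stable_def)
  show "emeasure M X \<noteq> \<infinity>" for i :: nat
    by simp
  fix A assume "A \<in> {A. A \<subseteq> X \<and> closed A}"
  then have A: "A \<subseteq> X" "closed A" by auto
  show "emeasure M A = emeasure N A"
  \<comment> \<open>The empty set is treated apart because \<open>infdist\<close> to it is 0 by
    convention, which would make every \<open>g k\<close> equal to 1.\<close>
  proof (cases "A = {}")
    case False
    define g where "g k x = max 0 (1 - real k * infdist x A)" for k x
    have g: "continuous_on X (g k)" "\<And>x. \<bar>g k x\<bar> \<le> 1" for k
      unfolding g_def using infdist_nonneg[of _ A] by (auto intro!: continuous_intros)
    have gl: "(\<lambda>k. g k x) \<longlonglongrightarrow> indicator A x" for x
    proof (cases "x \<in> A")
      case True
      then show ?thesis by (simp add: g_def)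
    next
      case xA: False
      then have "infdist x A > 0"
        using A(2) False infdist_pos_not_in_closed by blast
      then have "filterlim (\<lambda>k. real k * infdist x A) at_top sequentially"
        by (subst mult.commute)
          (rule filterlim_tendsto_pos_mult_at_top[OF tendsto_const _ filterlim_real_sequentially])
      then have "\<forall>\<^sub>F k in sequentially. real k * infdist x A \<ge> 1"
        by (simp add: filterlim_at_top)
      then have "\<forall>\<^sub>F k in sequentially. g k x = indicator A x"
        by eventually_elim (use xA in \<open>simp add: g_def\<close>)
      then show ?thesis
        by (rule tendsto_eventually)
    qed
    have L: "(\<lambda>k. LINT x|L. g k x) \<longlonglongrightarrow> measure L A"
      if L: "prob_space L" "sets L = sets (restrict_space borel X)" for L
    proof -
      interpret prob_space L by fact
      have "A \<in> sets L"
        using A assms(1) by (simp add: L(2) sets_restrict_space_iff)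
      have m: "g k \<in> borel_measurable L" for k
        using borel_measurable_continuous_on_restrict[OF g(1)] measurable_cong_sets[OF L(2) refl] by blast
      have "(\<lambda>k. LINT x|L. g k x) \<longlonglongrightarrow> (LINT x|L. indicator A x)"
        by (rule integral_dominated_convergence[where w = "\<lambda>_. 1"])
          (use gl g(2) m \<open>A \<in> sets L\<close> in auto)
      then show ?thesis
        using \<open>A \<in> sets L\<close> by simp
    qed
    have "measure M A = measure N A"
      using LIMSEQ_unique[OF L[OF assms(2) sM]] L[OF assms(3) sN] eq[OF g] by simp
    then show ?thesis
      by (simp add: M.emeasure_eq_measure N.emeasure_eq_measure)
  qed simp
qed (use assms(1) in auto)

text \<open>If convergence failed, the averages would stay at distance \<open>e\<close> from the
  integral along a subsequence. A further subsequence has a weak limit, which \<open>inv\<close>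
  makes \<open>T\<close>-invariant and unique ergodicity identifies with
  \<open>\<mu>\<close>.\<close>

lemma uniquely_ergodic_averages:
  fixes X :: "'a::metric_space set" and T :: "'a \<Rightarrow> 'a" and y :: "nat \<Rightarrow> 'a" and f :: "'a \<Rightarrow> real"
  assumes X: "compact X" and T: "T \<in> X \<rightarrow> X" "continuous_on X T"
    and ue: "uniquely_ergodic X T" and \<mu>: "invariant_prob_measure X T \<mu>"
    and y: "\<And>n. y n \<in> X"
    and inv: "\<And>g :: 'a \<Rightarrow> real. continuous_on X g \<Longrightarrow>
      (\<lambda>N. (\<Sum>n = 1..N. g (T (y n))) / real N - (\<Sum>n = 1..N. g (y n)) / real N) \<longlonglongrightarrow> 0"
    and f: "continuous_on X f"
  shows "(\<lambda>N. (\<Sum>n = 1..N. f (y n)) / real N) \<longlonglongrightarrow> (LINT x|\<mu>. f x)"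
proof (rule LIMSEQ_imp_Suc, rule ccontr)
  define a where "a g N = (\<Sum>n = 1..Suc N. g (y n)) / real (Suc N)" for g :: "'a \<Rightarrow> real" and N
  assume "\<not> (\<lambda>N. (\<Sum>n = 1..Suc N. f (y n)) / real (Suc N)) \<longlonglongrightarrow> (LINT x|\<mu>. f x)"
  then have "\<not> a f \<longlonglongrightarrow> (LINT x|\<mu>. f x)"
    by (simp add: a_def[abs_def])
  then obtain e where e: "e > 0" "\<exists>\<^sub>\<infinity>N. \<not> dist (a f N) (LINT x|\<mu>. f x) < e"
    unfolding tendsto_iff by (auto simp: not_eventually cofinite_eq_sequentially)
  define S where "S = {N. \<not> dist (a f N) (LINT x|\<mu>. f x) < e}"
  have "infinite S"
    using e(2) unfolding INFM_iff_infinite S_def .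
  then obtain s :: "nat \<Rightarrow> nat" where s: "strict_mono s" "\<And>k. s k \<in> S"
    using infinite_enumerate[of S] by blast
  obtain r \<nu> where r: "strict_mono (r :: nat \<Rightarrow> nat)" and \<nu>: "prob_space \<nu>"
    "sets \<nu> = sets (restrict_space borel X)"
    and lim': "\<forall>f :: 'a \<Rightarrow> real. continuous_on X f \<longrightarrow>
       (\<lambda>k. (\<Sum>n = 1..Suc (s (r k)). f (y n)) / Suc (s (r k))) \<longlonglongrightarrow> (LINT x|\<nu>. f x)"
    by (rule empirical_measure_limit[where y = y, OF X y s(1)])
  have lim: "(\<lambda>k. a g (s (r k))) \<longlonglongrightarrow> (LINT x|\<nu>. g x)" if "continuous_on X g" for g
    using lim' that by (simp add: a_def)
  have sp: "space \<nu> = X"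
    using sets_eq_imp_space_eq[OF \<nu>(2)] by (auto simp: space_restrict_space)
  have "T \<in> measurable (restrict_space borel X) (restrict_space borel X)"
    using T by (intro measurable_restrict_space2 borel_measurable_continuous_on_restrict)
      (auto simp: space_restrict_space)
  then have Tm: "T \<in> measurable \<nu> (restrict_space borel X)"
    using measurable_cong_sets[OF \<nu>(2) refl] by blast
  define \<nu>' where "\<nu>' = distr \<nu> (restrict_space borel X) T"
  \<comment> \<open>The integrals of \<open>g \<circ> T\<close> and \<open>g\<close> against
    \<open>\<nu>\<close> are limits of averages along the same subsequence, whose difference tends
    to 0 by \<open>inv\<close>.\<close>
  have "\<nu>' = \<nu>"
  proof (rule prob_measure_eq_by_continuous[OF compact_imp_closed[OF X]])
    show "prob_space \<nu>'"
      unfolding \<nu>'_def by (rule prob_space.prob_space_distr[OF \<nu>(1) Tm])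
    show "prob_space \<nu>" "sets \<nu> = sets (restrict_space borel X)" by fact+
    show "sets \<nu>' = sets (restrict_space borel X)"
      by (simp add: \<nu>'_def)
    fix g :: "'a \<Rightarrow> real" assume g: "continuous_on X g"
    have gT: "continuous_on X (g \<circ> T)"
      using T g by (intro continuous_on_compose continuous_on_subset[OF g]) auto
    have "filterlim (\<lambda>k. Suc (s (r k))) at_top sequentially"
      using s(1) r by (intro filterlim_subseq) (simp add: strict_mono_def)
    from filterlim_compose[OF inv[OF g] this]
    have "(\<lambda>k. a (g \<circ> T) (s (r k)) - a g (s (r k))) \<longlonglongrightarrow> 0"
      by (simp add: a_def o_def)
    moreover have "(\<lambda>k. a (g \<circ> T) (s (r k)) - a g (s (r k))) \<longlonglongrightarrow> (LINT x|\<nu>. (g \<circ> T) x) - (LINT x|\<nu>. g x)"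
      by (intro tendsto_diff lim gT g)
    ultimately have "(LINT x|\<nu>. (g \<circ> T) x) = (LINT x|\<nu>. g x)"
      using LIMSEQ_unique by fastforce
    then show "(LINT x|\<nu>'. g x) = (LINT x|\<nu>. g x)"
      unfolding \<nu>'_def
      by (subst integral_distr[OF Tm borel_measurable_continuous_on_restrict[OF g]]) simp
  qed
  then have "emeasure \<nu> (T -` A \<inter> X) = emeasure \<nu> A" if "A \<in> sets \<nu>" for A
    using emeasure_distr[OF Tm, of A] that \<nu>(2) sp by (simp add: \<nu>'_def)
  then have "invariant_prob_measure X T \<nu>"
    using \<nu> by (simp add: invariant_prob_measure_def)
  then have "\<nu> = \<mu>"
    using ue \<mu> unfolding uniquely_ergodic_def by blast
  then have "\<forall>\<^sub>F k in sequentially. dist (a f (s (r k))) (LINT x|\<mu>. f x) < e"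
    using tendstoD[OF lim[OF f] e(1)] by simp
  then show False
    using s(2) by (auto simp: eventually_sequentially S_def)
qed

theorem corollary1p9:
  fixes X :: "'a::metric_space set" and T :: "'a \<Rightarrow> 'a" and \<mu> :: "'a measure"
  assumes "compact X"
    and "T \<in> X \<rightarrow> X"
    and "continuous_on X T"
    and "uniquely_ergodic X T"
    and "invariant_prob_measure X T \<mu>"
  shows "\<forall>f :: 'a \<Rightarrow> complex. continuous_on X f \<longrightarrow>
    (\<forall>x \<in> X. (\<lambda>N::nat. (1 / of_nat N) * (\<Sum>n = 1..N. f ((T ^^ omega n) x)))
      \<longlonglongrightarrow> (LINT y|\<mu>. f y))"
proof (intro allI impI ballI)
  fix f :: "'a \<Rightarrow> complex" and x assume f: "continuous_on X f" and "x \<in> X"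
  have orbit: "(T ^^ k) x \<in> X" for k
    using \<open>x \<in> X\<close> assms(2) by (induction k) auto
  \<comment> \<open>Here \<open>y n\<close> is the point \<open>(T ^^ omega n) x\<close>. Applying
    \<open>T\<close> replaces \<open>omega n\<close> by \<open>Suc (omega n)\<close>, so the
    asymptotic invariance is the shift result for the sequence of values of \<open>h\<close> along
    the orbit.\<close>
  have lim: "(\<lambda>N. (\<Sum>n = 1..N. g ((T ^^ omega n) x)) / real N) \<longlonglongrightarrow> (LINT y|\<mu>. g y)"
    if "continuous_on X g" for g :: "'a \<Rightarrow> real"
  proof (rule uniquely_ergodic_averages[OF assms])
    fix h :: "'a \<Rightarrow> real" assume "continuous_on X h"
    then have "bounded (h ` X)"
      using assms(1) by (intro compact_imp_bounded compact_continuous_image)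
    then obtain B where "\<And>y. y \<in> X \<Longrightarrow> \<bar>h y\<bar> \<le> B"
      unfolding bounded_iff by auto
    then show "(\<lambda>N. (\<Sum>n = 1..N. h (T ((T ^^ omega n) x))) / real N
        - (\<Sum>n = 1..N. h ((T ^^ omega n) x)) / real N) \<longlonglongrightarrow> 0"
      using omega_shift_averages[of "\<lambda>k. h ((T ^^ k) x)" B] orbit by simp
  qed (use orbit that in auto)
  have "prob_space \<mu>" and sets: "sets \<mu> = sets (restrict_space borel X)"
    using assms(5) by (auto simp: invariant_prob_measure_def)
  then interpret prob_space \<mu> by simp
  have "space \<mu> = X"
    using sets_eq_imp_space_eq[OF sets] by (simp add: space_restrict_space)
  have "bounded (f ` X)"
    using f assms(1) by (intro compact_imp_bounded compact_continuous_image)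
  then obtain B where "\<And>y. y \<in> X \<Longrightarrow> norm (f y) \<le> B"
    unfolding bounded_iff by auto
  moreover have "f \<in> borel_measurable \<mu>"
    using borel_measurable_continuous_on_restrict[OF f] measurable_cong_sets[OF sets refl] by blast
  \<comment> \<open>Integrability lets the complex integral commute with real and imaginary parts,
    which reduces the claim to the real case.\<close>
  ultimately have int: "integrable \<mu> f"
    using \<open>space \<mu> = X\<close> by (intro integrable_const_bound[of _ B]) auto
  have "Re ((1 / of_nat N) * z) = Re z / real N" "Im ((1 / of_nat N) * z) = Im z / real N" for N z
    by (simp_all add: Re_divide_of_nat Im_divide_of_nat)
  then show "(\<lambda>N::nat. (1 / of_nat N) * (\<Sum>n = 1..N. f ((T ^^ omega n) x))) \<longlonglongrightarrow> (LINT y|\<mu>. f y)"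
    unfolding tendsto_complex_iff
    using lim[of "\<lambda>y. Re (f y)"] lim[of "\<lambda>y. Im (f y)"] f int
    by (simp add: continuous_on_Re continuous_on_Im)
qed

end
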